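(* Let $U$ be a chain of ideals of height $\xi\in\{1,2,3,\ldots,\omega\}$, with $\mathscr J=\mathscr D$-classes $D_0<D_1<\cdots$ (indexed by $0\le q<\xi$) and ideals $I_r=D_0\cup\cdots\cup D_r$ ($0\le r<\xi$), and $I_\omega=U$ if $\xi=\omega$. For each $0\le q<\xi$ let $G_q$ be a group $\mathscr H$-class contained in $D_q$. Suppose also that: - the minimal ideal $I_0=D_0$ is trivial, in the sense that each hom-set of $U$ contains a unique element of $D_0$, - for every $x\in D_1$ and $y\in D_1\setminus H_x$ with $x\sim y$, there exists $(x',y')\in(x,y)^\sharp_{I_1}$ with $x'\in D_1$ and $y'\in D_0$, - $\mathsf{Sep}^\zeta(I_r)$ holds for each $2\le r<\xi$. Then for any $r\ge0$ (i.e. $0\le r<\xi$, and also $r=\omega$ if $\xi=\omega$), the congruences on $I_r$ are precisely $\widetilde\nabla_{I_r}$ and those of the form $$R^{I_r}_{I_q,\mathbf N}=R^{I_r}_{I_q}\cup\nu_{N_{q+1}}\cup\nu_{N_{q+2}}\cup\cdots\qquad\text{for some }0\le q<r\text{ and some }\mathbf N=(N_{q+1},N_{q+2},\ldots)$$ (with indices running over all finite $p$ with $q+1\le p\le r$), where - $N_p\unlhd G_p$ for all $p\ge q+1$, - $N_p\le Z_p$ for all $p\ge q+2$, - $N_t^{\downarrow_p}\le N_p$ for all $t>p\ge q+1$.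
   Context: **Partial semigroups.** A partial semigroup is a 5-tuple $(S,\mathscr C,\mathbf d,\mathbf r,\cdot)$ with $\mathbf d,\mathbf r:S\to\mathscr C$ and $\cdot$ a partial binary operation on $S$ such that $xy$ is defined iff $\mathbf r(x)=\mathbf d(y)$, in which case $\mathbf d(xy)=\mathbf d(x)$ and $\mathbf r(xy)=\mathbf r(y)$, and $(xy)z=x(yz)$ whenever $xy$ and $yz$ are defined. The hom-sets are $S_{A,B}=\{x:\mathbf d(x)=A,\mathbf r(x)=B\}$, $A,B\in\mathscr C$. $S^1$ is the category obtained by adjoining identities at objects where needed. Write $x\sim y$ if $\mathbf d(x)=\mathbf d(y)$ and $\mathbf r(x)=\mathbf r(y)$. An ideal is a non-empty $I\subseteq S$ containing all defined products $sx$, $xs$ ($x\in I$, $s\in S$). $x$ is regular if $x=xax$ for some $a\in S$. Green's relations: $x\mathrel{\mathscr R}y\Leftrightarrow xS^1=yS^1$, $x\mathrel{\mathscr L}y\Leftrightarrow S^1x=S^1y$, $x\mathrel{\mathscr J}y\Leftrightarrow S^1xS^1=S^1yS^1$, $\mathscr H=\mathscr R\cap\mathscr L$, $\mathscr D=\mathscr R\vee\mathscr L$; $\mathscr J$-classes are ordered by $J_x\le J_y\Leftrightarrow x\in S^1yS^1$; $H_x$ is the $\mathscr H$-class of $x$. A $\mathscr J$-class $J$ is stable if for all $x\in J$, $a\in S$: $(x,xa)\in\mathscr J\Rightarrow(x,xa)\in\mathscr R$ and $(x,ax)\in\mathscr J\Rightarrow(x,ax)\in\mathscr L$. A chain of ideals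 of height $\xi$ is a regular partial semigroup all of whose $\mathscr J$-classes are stable and whose $\mathscr J=\mathscr D$-classes form a chain $D_0<D_1<\cdots$ of order type $\xi$. Green's relations on the $I_r$ are the restrictions of those on $U$. **Congruences.** A congruence on $S$ is an equivalence contained in $\sim$ and compatible with all defined left and right multiplications. $\Omega^\sharp_S$ (or $(x,y)^\sharp_S$) is the congruence on $S$ generated by $\Omega$ (or $(x,y)$). $\Delta_X$ is equality; $\widetilde\nabla_S=\{(x,y):x\sim y\}$; $R_I^S=\widetilde\nabla_I\cup\Delta_S$ for an ideal $I$. For $N\unlhd G_q$, $\nu_N=\{(axb,ayb):x,y\in N,\ a,b\in U^1,\ axb,ayb\in D_q\}$. $\zeta_S$ is the largest congruence on $S$ contained in $\mathscr H$. $Z_q=\{g\in G_q:(\mathrm{id}_{G_q},g)\in\zeta_U\}\unlhd G_q$ (so $\zeta_U{\restriction}_{D_q}=\nu_{Z_q}$). For $p\le q$ and $N\unlhd G_q$ with $N\le Z_q$, $N^{\downarrow_p}=\{g\in G_p:(\mathrm{id}_{G_p},g)\in(\nu_N)^\sharp_U\}\unlhd G_p$ (so $(\nu_N)_U^\sharp{\restriction}_{D_p}=\nu_{N^{\downarrow_p}}$). **Properties.** $\mathcal D\mathsf{max}(T)$: $T$ has a maximum $\mathscr J$-class, regular and stable, denoted $D_T$. $\mathsf{Sep}^\zeta(T)$: $\mathcal D\mathsf{max}(T)$ holds, $S=T\setminus D_T$ is an ideal satisfying $\mathcal D\mathsf{max}(S)$, and: (S1) for $x\in D_T$, $y\in S$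 with $x\sim y$ there is $(x',y')\in(x,y)^\sharp_T$ with $x'\in D_S$, $y'\in S\setminus H^S_{x'}$; (S2) for $x\in D_T$, $y\in D_T\setminus H_x^T$ with $x\sim y$ there is $(x',y')\in(x,y)^\sharp_T$ with $x'\in D_T$, $y'\in S$; (S3)$^\zeta$ for $x,y\in D_T$ with $(x,y)\in\mathscr H^T\setminus\zeta_T$ there is $(x',y')\in(x,y)^\sharp_T$ with $x'\in D_S$, $y'\in S\setminus H^S_{x'}$. *)

theory Defs
  imports "HOL-Algebra.Coset" "HOL-Library.Extended_Nat"
begin

section \<open>Partial semigroups\<close>

text \<open>The field \<open>mul\<close> is a total function; only its values at pairs with \<open>tgt x = src y\<close>
  are meaningful, and every definition below guards products accordingly.\<close>

record ('a, 'o) psg =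
  elts :: "'a set"
  objs :: "'o set"
  src :: "'a \<Rightarrow> 'o"
  tgt :: "'a \<Rightarrow> 'o"
  mul :: "'a \<Rightarrow> 'a \<Rightarrow> 'a" (infixl \<open>\<cdot>\<index>\<close> 70)

locale partial_semigroup =
  fixes S :: "('a, 'o) psg" (structure)
  assumes src_closed: "x \<in> elts S \<Longrightarrow> src S x \<in> objs S"
    and tgt_closed: "x \<in> elts S \<Longrightarrow> tgt S x \<in> objs S"
    and mul_closed: "\<lbrakk>x \<in> elts S; y \<in> elts S; tgt S x = src S y\<rbrakk> \<Longrightarrow> x \<cdot> y \<in> elts S"
    and src_mul: "\<lbrakk>x \<in> elts S; y \<in> elts S; tgt S x = src S y\<rbrakk> \<Longrightarrow> src S (x \<cdot> y) = src S x"
    and tgt_mul: "\<lbrakk>x \<in> elts S; y \<in> elts S; tgt S x = src S y\<rbrakk> \<Longrightarrow> tgt S (x \<cdot> y) = tgt S y"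
    and mul_assoc: "\<lbrakk>x \<in> elts S; y \<in> elts S; z \<in> elts S; tgt S x = src S y; tgt S y = src S z\<rbrakk>
      \<Longrightarrow> (x \<cdot> y) \<cdot> z = x \<cdot> (y \<cdot> z)"

definition sub :: "('a, 'o) psg \<Rightarrow> 'a set \<Rightarrow> ('a, 'o) psg" where
  "sub S I = S\<lparr>elts := I\<rparr>"

definition hom_set :: "('a, 'o) psg \<Rightarrow> 'o \<Rightarrow> 'o \<Rightarrow> 'a set" where
  "hom_set S A B = {x \<in> elts S. src S x = A \<and> tgt S x = B}"

definition parallel :: "('a, 'o) psg \<Rightarrow> 'a \<Rightarrow> 'a \<Rightarrow> bool" where
  "parallel S x y \<longleftrightarrow> src S x = src S y \<and> tgt S x = tgt S y"

definition has_identity :: "('a, 'o) psg \<Rightarrow> 'o \<Rightarrow> bool" where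
  "has_identity S A \<longleftrightarrow> (\<exists>e \<in> hom_set S A A.
     (\<forall>x \<in> elts S. src S x = A \<longrightarrow> e \<cdot>\<^bsub>S\<^esub> x = x) \<and> (\<forall>x \<in> elts S. tgt S x = A \<longrightarrow> x \<cdot>\<^bsub>S\<^esub> e = x))"

text \<open>The category \<open>S\<^sup>1\<close>: \<open>Inl x\<close> is the element \<open>x\<close> of \<open>S\<close>, and \<open>Inr A\<close> is the identity
  adjoined at an object \<open>A\<close> where \<open>S\<close> has none.\<close>

definition adjoin1 :: "('a, 'o) psg \<Rightarrow> ('a + 'o, 'o) psg" where
  "adjoin1 S = \<lparr>
     elts = Inl ` elts S \<union> Inr ` {A \<in> objs S. \<not> has_identity S A},
     objs = objs S,
     src = case_sum (src S) id,
     tgt = case_sum (tgt S) id,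
     mul = (\<lambda>a b. case a of
        Inr _ \<Rightarrow> b
      | Inl x \<Rightarrow> (case b of Inr _ \<Rightarrow> a | Inl y \<Rightarrow> Inl (x \<cdot>\<^bsub>S\<^esub> y)))\<rparr>"

definition psg_ideal :: "('a, 'o) psg \<Rightarrow> 'a set \<Rightarrow> bool" where
  "psg_ideal S I \<longleftrightarrow> I \<noteq> {} \<and> I \<subseteq> elts S \<and>
     (\<forall>x \<in> I. \<forall>s \<in> elts S. (tgt S s = src S x \<longrightarrow> s \<cdot>\<^bsub>S\<^esub> x \<in> I) \<and> (tgt S x = src S s \<longrightarrow> x \<cdot>\<^bsub>S\<^esub> s \<in> I))"

definition regular_elt :: "('a, 'o) psg \<Rightarrow> 'a \<Rightarrow> bool" where
  "regular_elt S x \<longleftrightarrow> (\<exists>a \<in> elts S. tgt S x = src S a \<and> tgt S a = src S x \<and> x = x \<cdot>\<^bsub>S\<^esub> a \<cdot>\<^bsub>S\<^esub> x)"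


section \<open>Green's relations\<close>

text \<open>The principal one- and two-sided ideals \<open>xS\<^sup>1\<close>, \<open>S\<^sup>1x\<close>, \<open>S\<^sup>1xS\<^sup>1\<close>, as subsets of \<open>S\<^sup>1\<close>.\<close>

definition right_principal :: "('a, 'o) psg \<Rightarrow> 'a \<Rightarrow> ('a + 'o) set" where
  "right_principal S x = {Inl x \<cdot>\<^bsub>adjoin1 S\<^esub> b | b.
     b \<in> elts (adjoin1 S) \<and> tgt S x = src (adjoin1 S) b}"

definition left_principal :: "('a, 'o) psg \<Rightarrow> 'a \<Rightarrow> ('a + 'o) set" where
  "left_principal S x = {a \<cdot>\<^bsub>adjoin1 S\<^esub> Inl x | a.
     a \<in> elts (adjoin1 S) \<and> tgt (adjoin1 S) a = src S x}"

definition principal :: "('a, 'o) psg \<Rightarrow> 'a \<Rightarrow> ('a + 'o) set" where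
  "principal S x = {a \<cdot>\<^bsub>adjoin1 S\<^esub> Inl x \<cdot>\<^bsub>adjoin1 S\<^esub> b | a b.
     a \<in> elts (adjoin1 S) \<and> b \<in> elts (adjoin1 S) \<and>
     tgt (adjoin1 S) a = src S x \<and> tgt S x = src (adjoin1 S) b}"

definition green_R :: "('a, 'o) psg \<Rightarrow> 'a rel" where
  "green_R S = {(x, y) \<in> elts S \<times> elts S. right_principal S x = right_principal S y}"

definition green_L :: "('a, 'o) psg \<Rightarrow> 'a rel" where
  "green_L S = {(x, y) \<in> elts S \<times> elts S. left_principal S x = left_principal S y}"

definition green_J :: "('a, 'o) psg \<Rightarrow> 'a rel" where
  "green_J S = {(x, y) \<in> elts S \<times> elts S. principal S x = principal S y}"

definition green_H :: "('a, 'o) psg \<Rightarrow> 'a rel" where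
  "green_H S = green_R S \<inter> green_L S"

definition green_D :: "('a, 'o) psg \<Rightarrow> 'a rel" where
  "green_D S = \<Inter>{E. equiv (elts S) E \<and> green_R S \<union> green_L S \<subseteq> E}"

abbreviation H_class :: "('a, 'o) psg \<Rightarrow> 'a \<Rightarrow> 'a set" where
  "H_class S x \<equiv> green_H S `` {x}"

abbreviation J_classes :: "('a, 'o) psg \<Rightarrow> 'a set set" where
  "J_classes S \<equiv> elts S // green_J S"

definition J_le :: "('a, 'o) psg \<Rightarrow> 'a set \<Rightarrow> 'a set \<Rightarrow> bool" where
  "J_le S X Y \<longleftrightarrow> (\<exists>x \<in> X. \<exists>y \<in> Y. Inl x \<in> principal S y)"

definition stable :: "('a, 'o) psg \<Rightarrow> 'a set \<Rightarrow> bool" where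
  "stable S J \<longleftrightarrow> (\<forall>x \<in> J. \<forall>a \<in> elts S.
     (tgt S x = src S a \<longrightarrow> (x, x \<cdot>\<^bsub>S\<^esub> a) \<in> green_J S \<longrightarrow> (x, x \<cdot>\<^bsub>S\<^esub> a) \<in> green_R S) \<and>
     (tgt S a = src S x \<longrightarrow> (x, a \<cdot>\<^bsub>S\<^esub> x) \<in> green_J S \<longrightarrow> (x, a \<cdot>\<^bsub>S\<^esub> x) \<in> green_L S))"

text \<open>The order type \<open>\<xi> \<in> {1, 2, 3, \<dots>, \<omega>}\<close> is an extended natural number, with \<open>\<infinity>\<close> for
  \<open>\<omega>\<close>; \<open>D q\<close> is only constrained for \<open>q < \<xi>\<close>. By \<open>stable_imp_J_eq_D\<close> below, stability makes the
  \<open>\<J>\<close>-classes the same as the \<open>\<D>\<close>-classes.\<close>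

definition chain_of_ideals :: "('a, 'o) psg \<Rightarrow> enat \<Rightarrow> (nat \<Rightarrow> 'a set) \<Rightarrow> bool" where
  "chain_of_ideals U \<xi> D \<longleftrightarrow>
     partial_semigroup U \<and> (\<forall>x \<in> elts U. regular_elt U x) \<and> (\<forall>J \<in> J_classes U. stable U J) \<and>
     D ` {q. enat q < \<xi>} = J_classes U \<and>
     (\<forall>p q. enat p < \<xi> \<longrightarrow> enat q < \<xi> \<longrightarrow> (J_le U (D p) (D q) \<longleftrightarrow> p \<le> q))"

text \<open>\<open>I_layer D r\<close> is \<open>D\<^sub>0 \<union> \<dots> \<union> D\<^sub>r\<close> for finite \<open>r\<close>, and the union of all \<open>D\<^sub>q\<close> for \<open>r = \<infinity>\<close>.\<close>

definition I_layer :: "(nat \<Rightarrow> 'a set) \<Rightarrow> enat \<Rightarrow> 'a set" where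
  "I_layer D r = (\<Union>q \<in> {q. enat q \<le> r}. D q)"


section \<open>Congruences\<close>

definition psg_cong :: "('a, 'o) psg \<Rightarrow> 'a rel \<Rightarrow> bool" where
  "psg_cong S \<sigma> \<longleftrightarrow> equiv (elts S) \<sigma> \<and> (\<forall>(x, y) \<in> \<sigma>. parallel S x y \<and>
     (\<forall>a \<in> elts S. (tgt S a = src S x \<longrightarrow> (a \<cdot>\<^bsub>S\<^esub> x, a \<cdot>\<^bsub>S\<^esub> y) \<in> \<sigma>) \<and>
                   (tgt S x = src S a \<longrightarrow> (x \<cdot>\<^bsub>S\<^esub> a, y \<cdot>\<^bsub>S\<^esub> a) \<in> \<sigma>)))"

definition cong_gen :: "('a, 'o) psg \<Rightarrow> 'a rel \<Rightarrow> 'a rel" where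
  "cong_gen S \<Omega> = \<Inter>{\<sigma>. psg_cong S \<sigma> \<and> \<Omega> \<subseteq> \<sigma>}"

definition nabla :: "('a, 'o) psg \<Rightarrow> 'a set \<Rightarrow> 'a rel" where
  "nabla S X = {(x, y) \<in> X \<times> X. parallel S x y}"

definition rees :: "('a, 'o) psg \<Rightarrow> 'a set \<Rightarrow> 'a rel" where
  "rees S I = nabla S I \<union> Id_on (elts S)"

text \<open>The largest congruence contained in \<open>\<H>\<close>; see \<open>zeta_greatest\<close> below.\<close>

definition zeta :: "('a, 'o) psg \<Rightarrow> 'a rel" where
  "zeta S = \<Union>{\<sigma>. psg_cong S \<sigma> \<and> \<sigma> \<subseteq> green_H S}"

definition class_group :: "('a, 'o) psg \<Rightarrow> 'a set \<Rightarrow> 'a monoid" where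
  "class_group S G = \<lparr>carrier = G, mult = mul S,
     one = (THE e. e \<in> G \<and> (\<forall>x \<in> G. e \<cdot>\<^bsub>S\<^esub> x = x \<and> x \<cdot>\<^bsub>S\<^esub> e = x))\<rparr>"

definition group_H_class :: "('a, 'o) psg \<Rightarrow> 'a set \<Rightarrow> bool" where
  "group_H_class S G \<longleftrightarrow> G \<in> elts S // green_H S \<and>
     (\<forall>x \<in> G. \<forall>y \<in> G. tgt S x = src S y) \<and> group (class_group S G)"

text \<open>In \<open>nu U Dq N\<close>, \<open>Dq\<close> is the \<open>\<D>\<close>-class containing the group \<open>\<H>\<close>-class of which \<open>N\<close> is a
  normal subgroup.\<close>

definition nu :: "('a, 'o) psg \<Rightarrow> 'a set \<Rightarrow> 'a set \<Rightarrow> 'a rel" where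
  "nu U Dq N = {(u, v) \<in> Dq \<times> Dq. \<exists>x \<in> N. \<exists>y \<in> N. \<exists>a \<in> elts (adjoin1 U). \<exists>b \<in> elts (adjoin1 U).
     tgt (adjoin1 U) a = src U x \<and> tgt U x = src (adjoin1 U) b \<and>
     tgt (adjoin1 U) a = src U y \<and> tgt U y = src (adjoin1 U) b \<and>
     Inl u = a \<cdot>\<^bsub>adjoin1 U\<^esub> Inl x \<cdot>\<^bsub>adjoin1 U\<^esub> b \<and>
     Inl v = a \<cdot>\<^bsub>adjoin1 U\<^esub> Inl y \<cdot>\<^bsub>adjoin1 U\<^esub> b}"

text \<open>\<open>Z_grp U G\<^sub>q\<close> is \<open>Z\<^sub>q\<close>, and \<open>down U D\<^sub>q N G\<^sub>p\<close> is the subgroup of \<open>G\<^sub>p\<close> that \<open>N\<close>, a normal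
  subgroup of \<open>G\<^sub>q\<close>, induces at the lower level \<open>p\<close>.\<close>

definition Z_grp :: "('a, 'o) psg \<Rightarrow> 'a set \<Rightarrow> 'a set" where
  "Z_grp U G = {g \<in> G. (\<one>\<^bsub>class_group U G\<^esub>, g) \<in> zeta U}"

definition down :: "('a, 'o) psg \<Rightarrow> 'a set \<Rightarrow> 'a set \<Rightarrow> 'a set \<Rightarrow> 'a set" where
  "down U Dq N Gp = {g \<in> Gp. (\<one>\<^bsub>class_group U Gp\<^esub>, g) \<in> cong_gen U (nu U Dq N)}"


section \<open>The separation property\<close>

definition max_J_class :: "('a, 'o) psg \<Rightarrow> 'a set \<Rightarrow> bool" where
  "max_J_class T M \<longleftrightarrow> M \<in> J_classes T \<and> (\<forall>K \<in> J_classes T. J_le T K M)"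

definition top_J :: "('a, 'o) psg \<Rightarrow> 'a set" where
  "top_J T = (THE M. max_J_class T M)"

definition Dmax :: "('a, 'o) psg \<Rightarrow> bool" where
  "Dmax T \<longleftrightarrow> (\<exists>M. max_J_class T M) \<and> (\<forall>x \<in> top_J T. regular_elt T x) \<and> stable T (top_J T)"

definition Sep_zeta :: "('a, 'o) psg \<Rightarrow> bool" where
  "Sep_zeta T \<longleftrightarrow> Dmax T \<and>
     (let S = sub T (elts T - top_J T) in
        psg_ideal T (elts S) \<and> Dmax S \<and>
        (\<forall>x \<in> top_J T. \<forall>y \<in> elts S. parallel T x y \<longrightarrow>
           (\<exists>(x', y') \<in> cong_gen T {(x, y)}. x' \<in> top_J S \<and> y' \<in> elts S - H_class S x')) \<and>
        (\<forall>x \<in> top_J T. \<forall>y \<in> top_J T - H_class T x. parallel T x y \<longrightarrow>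
           (\<exists>(x', y') \<in> cong_gen T {(x, y)}. x' \<in> top_J T \<and> y' \<in> elts S)) \<and>
        (\<forall>x \<in> top_J T. \<forall>y \<in> top_J T. (x, y) \<in> green_H T - zeta T \<longrightarrow>
           (\<exists>(x', y') \<in> cong_gen T {(x, y)}. x' \<in> top_J S \<and> y' \<in> elts S - H_class S x')))"


section \<open>Basic facts about the definitions\<close>

lemma adjoin1_simps [simp]:
  "objs (adjoin1 S) = objs S"
  "src (adjoin1 S) (Inl x) = src S x" "src (adjoin1 S) (Inr A) = A"
  "tgt (adjoin1 S) (Inl x) = tgt S x" "tgt (adjoin1 S) (Inr A) = A"
  "Inl x \<cdot>\<^bsub>adjoin1 S\<^esub> Inl y = Inl (x \<cdot>\<^bsub>S\<^esub> y)"
  "Inr A \<cdot>\<^bsub>adjoin1 S\<^esub> b = b"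
  "Inl x \<cdot>\<^bsub>adjoin1 S\<^esub> Inr A = Inl x"
  "Inl x \<in> elts (adjoin1 S) \<longleftrightarrow> x \<in> elts S"
  "Inr A \<in> elts (adjoin1 S) \<longleftrightarrow> A \<in> objs S \<and> \<not> has_identity S A"
  by (auto simp: adjoin1_def)

context partial_semigroup
begin

lemma adjoin1_psg: "partial_semigroup (adjoin1 S)"
proof
  fix x y z :: "'a + 'o"
  show "x \<in> elts (adjoin1 S) \<Longrightarrow> src (adjoin1 S) x \<in> objs (adjoin1 S)"
    by (cases x) (auto simp: src_closed)
  show "x \<in> elts (adjoin1 S) \<Longrightarrow> tgt (adjoin1 S) x \<in> objs (adjoin1 S)"
    by (cases x) (auto simp: tgt_closed)
  assume x: "x \<in> elts (adjoin1 S)" and y: "y \<in> elts (adjoin1 S)" 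
    and xy: "tgt (adjoin1 S) x = src (adjoin1 S) y"
  show "x \<cdot>\<^bsub>adjoin1 S\<^esub> y \<in> elts (adjoin1 S)"
    using x y xy by (cases x; cases y) (auto simp: mul_closed)
  show "src (adjoin1 S) (x \<cdot>\<^bsub>adjoin1 S\<^esub> y) = src (adjoin1 S) x"
    using x y xy by (cases x; cases y) (auto simp: src_mul)
  show "tgt (adjoin1 S) (x \<cdot>\<^bsub>adjoin1 S\<^esub> y) = tgt (adjoin1 S) y"
    using x y xy by (cases x; cases y) (auto simp: tgt_mul)
  assume z: "z \<in> elts (adjoin1 S)" and yz: "tgt (adjoin1 S) y = src (adjoin1 S) z"
  show "x \<cdot>\<^bsub>adjoin1 S\<^esub> y \<cdot>\<^bsub>adjoin1 S\<^esub> z = x \<cdot>\<^bsub>adjoin1 S\<^esub> (y \<cdot>\<^bsub>adjoin1 S\<^esub> z)"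
    using x y xy z yz by (cases x; cases y; cases z) (auto simp: mul_assoc)
qed

lemma adjoin1_identity:
  assumes "A \<in> objs S"
  shows "has_identity (adjoin1 S) A"
proof (cases "has_identity S A")
  case True
  then obtain e where e: "e \<in> hom_set S A A"
      "\<And>x. x \<in> elts S \<Longrightarrow> src S x = A \<Longrightarrow> e \<cdot> x = x"
      "\<And>x. x \<in> elts S \<Longrightarrow> tgt S x = A \<Longrightarrow> x \<cdot> e = x"
    by (auto simp: has_identity_def)
  have 1: "Inl e \<cdot>\<^bsub>adjoin1 S\<^esub> x = x" if "x \<in> elts (adjoin1 S)" "src (adjoin1 S) x = A" for x
    using that e True by (cases x) auto
  have 2: "x \<cdot>\<^bsub>adjoin1 S\<^esub> Inl e = x" if "x \<in> elts (adjoin1 S)" "tgt (adjoin1 S) x = A" for x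
    using that e True by (cases x) auto
  have "Inl e \<in> hom_set (adjoin1 S) A A"
    using e by (auto simp: hom_set_def)
  then show ?thesis
    using 1 2 unfolding has_identity_def by blast
next
  case False
  have 2: "x \<cdot>\<^bsub>adjoin1 S\<^esub> Inr A = x" if "x \<in> elts (adjoin1 S)" "tgt (adjoin1 S) x = A" for x
    using that by (cases x) auto
  have "Inr A \<in> hom_set (adjoin1 S) A A"
    using False assms by (auto simp: hom_set_def)
  moreover have "Inr A \<cdot>\<^bsub>adjoin1 S\<^esub> x = x" for x
    by simp
  ultimately show ?thesis
    using 2 unfolding has_identity_def by blast
qed

lemma self_in_principal:
  assumes "x \<in> elts S"
  shows "Inl x \<in> principal S x"
proof -
  have "Inl x \<in> elts (adjoin1 S)"
    using assms by simp
  obtain e where e: "e \<in> hom_set (adjoin1 S) (src S x) (src S x)" "e \<cdot>\<^bsub>adjoin1 S\<^esub> Inl x = Inl x"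
    using adjoin1_identity[of "src S x"] assms unfolding has_identity_def
    by (metis adjoin1_simps(2) adjoin1_simps(9) src_closed)
  obtain f where f: "f \<in> hom_set (adjoin1 S) (tgt S x) (tgt S x)" "Inl x \<cdot>\<^bsub>adjoin1 S\<^esub> f = Inl x"
    using adjoin1_identity[of "tgt S x"] assms unfolding has_identity_def
    by (metis adjoin1_simps(4) adjoin1_simps(9) tgt_closed)
  have "e \<cdot>\<^bsub>adjoin1 S\<^esub> Inl x \<cdot>\<^bsub>adjoin1 S\<^esub> f = Inl x"
    using e f by simp
  then show ?thesis
    using e(1) f(1) unfolding principal_def hom_set_def by force
qed

lemma principal_mono:
  assumes x: "x \<in> elts S" and y: "y \<in> elts S" and xy: "Inl x \<in> principal S y"
  shows "principal S x \<subseteq> principal S y"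
proof
  interpret T: partial_semigroup "adjoin1 S" by (rule adjoin1_psg)
  let ?m = "mul (adjoin1 S)"
  fix w assume "w \<in> principal S x"
  then obtain a b where a: "a \<in> elts (adjoin1 S)" and b: "b \<in> elts (adjoin1 S)"
    and ab: "tgt (adjoin1 S) a = src S x" "tgt S x = src (adjoin1 S) b" "w = ?m (?m a (Inl x)) b"
    unfolding principal_def by blast
  from xy obtain c d where c: "c \<in> elts (adjoin1 S)" and d: "d \<in> elts (adjoin1 S)"
    and cd: "tgt (adjoin1 S) c = src S y" "tgt S y = src (adjoin1 S) d"
      "Inl x = ?m (?m c (Inl y)) d"
    unfolding principal_def by blast
  have Y: "Inl y \<in> elts (adjoin1 S)" using y by simp
  have cy: "?m c (Inl y) \<in> elts (adjoin1 S)" "tgt (adjoin1 S) (?m c (Inl y)) = tgt S y"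
      "src (adjoin1 S) (?m c (Inl y)) = src (adjoin1 S) c"
    using c Y cd T.mul_closed T.tgt_mul T.src_mul by auto
  have sx: "src S x = src (adjoin1 S) c"
    using T.src_mul[OF cy(1) d] cy cd by (metis adjoin1_simps(2))
  have tx: "tgt S x = tgt (adjoin1 S) d"
    using T.tgt_mul[OF cy(1) d] cy cd by (metis adjoin1_simps(4))
  have ac: "?m a c \<in> elts (adjoin1 S)" "tgt (adjoin1 S) (?m a c) = src S y"
    using T.mul_closed[OF a c] T.tgt_mul[OF a c] ab sx cd by auto
  have db: "?m d b \<in> elts (adjoin1 S)" "src (adjoin1 S) (?m d b) = tgt S y"
    using T.mul_closed[OF d b] T.src_mul[OF d b] ab tx cd by auto
  have acy: "?m a (?m c (Inl y)) \<in> elts (adjoin1 S)"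
      "tgt (adjoin1 S) (?m a (?m c (Inl y))) = tgt S y"
    using T.mul_closed[OF a cy(1)] T.tgt_mul[OF a cy(1)] ab sx cy by auto
  have "w = ?m (?m a (?m (?m c (Inl y)) d)) b"
    using ab cd by simp
  also have "\<dots> = ?m (?m (?m a (?m c (Inl y))) d) b"
    using T.mul_assoc[OF a cy(1) d] ab sx cy cd by simp
  also have "\<dots> = ?m (?m a (?m c (Inl y))) (?m d b)"
    using T.mul_assoc[OF acy(1) d b] acy cd tx ab by simp
  also have "?m a (?m c (Inl y)) = ?m (?m a c) (Inl y)"
    using T.mul_assoc[OF a c Y] ab sx cd by simp
  finally show "w \<in> principal S y"
    unfolding principal_def using ac db by force
qed

lemma green_J_iff:
  assumes "x \<in> elts S" "y \<in> elts S"
  shows "(x, y) \<in> green_J S \<longleftrightarrow> Inl x \<in> principal S y \<and> Inl y \<in> principal S x"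
  using assms self_in_principal principal_mono unfolding green_J_def by blast

lemma right_mul_in_principal:
  assumes x: "x \<in> elts S" and b: "b \<in> elts (adjoin1 S)" and xb: "tgt S x = src (adjoin1 S) b"
  shows "Inl x \<cdot>\<^bsub>adjoin1 S\<^esub> b \<in> principal S x"
proof -
  obtain e where e: "e \<in> hom_set (adjoin1 S) (src S x) (src S x)" "e \<cdot>\<^bsub>adjoin1 S\<^esub> Inl x = Inl x"
    using adjoin1_identity[of "src S x"] x unfolding has_identity_def
    by (metis adjoin1_simps(2) adjoin1_simps(9) src_closed)
  then show ?thesis
    using b xb unfolding principal_def hom_set_def by force
qed

lemma left_mul_in_principal:
  assumes x: "x \<in> elts S" and a: "a \<in> elts (adjoin1 S)" and ax: "tgt (adjoin1 S) a = src S x"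
  shows "a \<cdot>\<^bsub>adjoin1 S\<^esub> Inl x \<in> principal S x"
proof -
  interpret T: partial_semigroup "adjoin1 S" by (rule adjoin1_psg)
  have X: "Inl x \<in> elts (adjoin1 S)" using x by simp
  obtain f where f: "f \<in> hom_set (adjoin1 S) (tgt S x) (tgt S x)" "Inl x \<cdot>\<^bsub>adjoin1 S\<^esub> f = Inl x"
    using adjoin1_identity[of "tgt S x"] x unfolding has_identity_def
    by (metis adjoin1_simps(4) adjoin1_simps(9) tgt_closed)
  have "a \<cdot>\<^bsub>adjoin1 S\<^esub> Inl x \<cdot>\<^bsub>adjoin1 S\<^esub> f = a \<cdot>\<^bsub>adjoin1 S\<^esub> Inl x"
    using T.mul_assoc[OF a X, of f] f ax by (simp add: hom_set_def)
  then show ?thesis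
    using a ax f(1) unfolding principal_def hom_set_def by force
qed

lemma green_R_subset_J: "green_R S \<subseteq> green_J S"
proof -
  have "Inl x \<in> principal S y"
    if x: "x \<in> elts S" and y: "y \<in> elts S" and eq: "right_principal S x = right_principal S y" for x y
  proof -
    obtain f where "f \<in> hom_set (adjoin1 S) (tgt S x) (tgt S x)" "Inl x \<cdot>\<^bsub>adjoin1 S\<^esub> f = Inl x"
      using adjoin1_identity[of "tgt S x"] x unfolding has_identity_def
      by (metis adjoin1_simps(4) adjoin1_simps(9) tgt_closed)
    then have "Inl x \<in> right_principal S x"
      unfolding right_principal_def hom_set_def by force
    then show ?thesis
      using eq right_mul_in_principal[OF y] unfolding right_principal_def by auto
  qed
  then show ?thesis
    by (auto simp: green_R_def green_J_iff)
qed

lemma green_L_subset_J: "green_L S \<subseteq> green_J S"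
proof -
  have "Inl x \<in> principal S y"
    if x: "x \<in> elts S" and y: "y \<in> elts S" and eq: "left_principal S x = left_principal S y" for x y
  proof -
    obtain f where "f \<in> hom_set (adjoin1 S) (src S x) (src S x)" "f \<cdot>\<^bsub>adjoin1 S\<^esub> Inl x = Inl x"
      using adjoin1_identity[of "src S x"] x unfolding has_identity_def
      by (metis adjoin1_simps(2) adjoin1_simps(9) src_closed)
    then have "Inl x \<in> left_principal S x"
      unfolding left_principal_def hom_set_def by force
    then show ?thesis
      using eq left_mul_in_principal[OF y] unfolding left_principal_def by auto
  qed
  then show ?thesis
    by (auto simp: green_L_def green_J_iff)
qed

lemma equiv_green_J: "equiv (elts S) (green_J S)"
  by (rule equivI) (auto simp: green_J_def refl_on_def sym_def trans_def)

theorem stable_imp_J_eq_D: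
  assumes st: "\<And>J. J \<in> J_classes S \<Longrightarrow> stable S J"
  shows "green_J S = green_D S"
proof
  show "green_D S \<subseteq> green_J S"
    unfolding green_D_def using equiv_green_J green_R_subset_J green_L_subset_J by blast
next
  have stR: "(x, x \<cdot> a) \<in> green_R S"
    if "x \<in> elts S" "a \<in> elts S" "tgt S x = src S a" "(x, x \<cdot> a) \<in> green_J S" for x a
    using st[of "green_J S `` {x}"] that equiv_green_J
    unfolding stable_def by (meson equiv_class_self quotientI)
  have stL: "(x, a \<cdot> x) \<in> green_L S"
    if "x \<in> elts S" "a \<in> elts S" "tgt S a = src S x" "(x, a \<cdot> x) \<in> green_J S" for x a
    using st[of "green_J S `` {x}"] that equiv_green_J
    unfolding stable_def by (meson equiv_class_self quotientI)
  show "green_J S \<subseteq> green_D S"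
  proof (rule subrelI)
    fix x y assume xy: "(x, y) \<in> green_J S"
    then have x: "x \<in> elts S" and y: "y \<in> elts S"
      by (auto simp: green_J_def)
    from xy obtain a b where a: "a \<in> elts (adjoin1 S)" and b: "b \<in> elts (adjoin1 S)"
      and ab: "tgt (adjoin1 S) a = src S x" "tgt S x = src (adjoin1 S) b"
        "Inl y = a \<cdot>\<^bsub>adjoin1 S\<^esub> Inl x \<cdot>\<^bsub>adjoin1 S\<^esub> b"
      using green_J_iff[OF x y] unfolding principal_def by blast
    interpret T: partial_semigroup "adjoin1 S" by (rule adjoin1_psg)
    obtain c where c: "Inl c = a \<cdot>\<^bsub>adjoin1 S\<^esub> Inl x"
      by (cases a) auto
    have cS: "c \<in> elts S" and tc: "tgt S c = tgt S x"
      using T.mul_closed[OF a, of "Inl x"] T.tgt_mul[OF a, of "Inl x"] ab x c[symmetric] by auto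
    have cx: "Inl c \<in> principal S x"
      using left_mul_in_principal[OF x a ab(1)] c by simp
    have yc: "Inl y \<in> principal S c"
      using right_mul_in_principal[OF cS b] tc ab c by simp
    have "Inl x \<in> principal S y"
      using xy green_J_iff[OF x y] by blast
    then have xc: "Inl x \<in> principal S c" and cy: "Inl c \<in> principal S y"
      using yc cx principal_mono x y cS by blast+
    have L: "(x, c) \<in> green_L S"
    proof (cases a)
      case (Inl a')
      then show ?thesis
        using stL[OF x, of a'] a ab(1) c cx xc green_J_iff[OF x cS] by auto
    next
      case (Inr A)
      then show ?thesis using c x by (auto simp: green_L_def)
    qed
    have R: "(c, y) \<in> green_R S"
    proof (cases b)
      case (Inl b')
      then show ?thesis
        using stR[OF cS, of b'] b ab c[symmetric] tc yc cy green_J_iff[OF cS y] by auto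
    next
      case (Inr A)
      then show ?thesis using c[symmetric] ab y by (auto simp: green_R_def)
    qed
    show "(x, y) \<in> green_D S"
      unfolding green_D_def using L R by (blast dest: equiv_type elim: equivE transE)
  qed
qed

lemma zeta_greatest:
  shows "psg_cong S (zeta S)" and "zeta S \<subseteq> green_H S"
    and "\<And>\<sigma>. psg_cong S \<sigma> \<Longrightarrow> \<sigma> \<subseteq> green_H S \<Longrightarrow> \<sigma> \<subseteq> zeta S"
proof -
  let ?C = "{\<sigma>. psg_cong S \<sigma> \<and> \<sigma> \<subseteq> green_H S}"
  show sub: "zeta S \<subseteq> green_H S" by (auto simp: zeta_def)
  show "\<And>\<sigma>. psg_cong S \<sigma> \<Longrightarrow> \<sigma> \<subseteq> green_H S \<Longrightarrow> \<sigma> \<subseteq> zeta S"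
    by (auto simp: zeta_def)
  let ?T = "(zeta S)\<^sup>+"
  have eqH: "equiv (elts S) (green_H S)"
    by (rule equivI) (auto simp: green_H_def green_R_def green_L_def refl_on_def sym_def trans_def)
  have trH: "?T \<subseteq> green_H S"
    using sub eqH by (metis equivE trancl_id trancl_mono_subset)
  have Id: "psg_cong S (Id_on (elts S))"
    by (auto simp: psg_cong_def parallel_def Id_on_def equiv_def refl_on_def sym_def trans_def
        mul_closed)
  have "Id_on (elts S) \<subseteq> green_H S"
    by (auto simp: green_H_def green_R_def green_L_def)
  with Id have Idz: "Id_on (elts S) \<subseteq> zeta S"
    by (auto simp: zeta_def)
  have symz: "sym (zeta S)"
    unfolding zeta_def sym_def psg_cong_def by (blast elim: equivE dest: symD)
  have eqT: "equiv (elts S) ?T"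
  proof (rule equivI)
    show "?T \<subseteq> elts S \<times> elts S" using trH by (auto simp: green_H_def green_R_def)
    show "refl_on (elts S) ?T" using Idz by (auto simp: refl_on_def)
    show "sym ?T" using symz by (rule sym_trancl)
    show "trans ?T" by simp
  qed
  have one: "parallel S x y \<and>
     (\<forall>a \<in> elts S. (tgt S a = src S x \<longrightarrow> (a \<cdot> x, a \<cdot> y) \<in> zeta S) \<and>
                   (tgt S x = src S a \<longrightarrow> (x \<cdot> a, y \<cdot> a) \<in> zeta S))"
    if "(x, y) \<in> zeta S" for x y
    using that unfolding zeta_def psg_cong_def by fast
  have "parallel S x y \<and>
     (\<forall>a \<in> elts S. (tgt S a = src S x \<longrightarrow> (a \<cdot> x, a \<cdot> y) \<in> ?T) \<and>
                   (tgt S x = src S a \<longrightarrow> (x \<cdot> a, y \<cdot> a) \<in> ?T))"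
    if "(x, y) \<in> ?T" for x y
    using that
  proof (induction rule: trancl_induct)
    case (base y)
    then show ?case using one by blast
  next
    case (step y z)
    then show ?case
      using one[OF step(2)] unfolding parallel_def by (metis (no_types, lifting) trancl.trancl_into_trancl)
  qed
  then have "psg_cong S ?T"
    using eqT by (auto simp: psg_cong_def)
  then have "?T = zeta S"
    using trH by (auto simp: zeta_def)
  then show "psg_cong S (zeta S)"
    using \<open>psg_cong S ?T\<close> by simp
qed

end

end

(* Proof idea. Let sigma be a congruence on I_r other than the full one, and let q be maximal such
   that sigma identifies all parallel elements of I_q. The separation hypotheses push a sigma-related
   pair that leaves an H-class, or that meets two different levels, one level down at a time until it
   collapses a whole ideal I_p with p > q, which is impossible. A pair at level p >= q + 2 that is
   H-related but not in zeta is sent to level p - 1 and collapses I_(p-1). Hence above I_q the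
   congruence lies in H (and in zeta from level q + 2 on), where it is determined at each level by a
   normal subgroup of the group H-class, via u = a e b and v = a x b with x in that group.
   Conversely, multiplying a pair of nu_(N_p) keeps it H-related; if it falls to a level k with
   q < k < p, then p >= q + 2, so nu_(N_p) generates a congruence inside H, and the condition on the
   subgroup induced by N_p at level k puts the product into nu_(N_k). *)

theory Submission
  imports Defs
begin

section \<open>Green's preorders in a regular partial semigroup\<close>

text \<open>Regularity removes the adjoined identities: x = x a x gives x the local identities x a
  and a x, and these lie in every ideal containing x. Multipliers can therefore be taken from
  \<open>S\<close>, or from an ideal, and Green's relations of I_r are restrictions of those of U.
  The obstacle is that three ambient structures occur: \<sigma> lives on I_r, the separation
  hypotheses on the truncations I_p, and \<open>zeta\<close> and \<open>down\<close> on all of U.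
  Passing downwards is restriction. The proof passes upwards only inside H: a congruence contained
  in H on an ideal extends to U by equality, because one local identity then fixes both members of a
  pair. This puts zeta of I_p inside zeta of U, and it turns the part of \<sigma> inside zeta into a
  congruence on U that bounds \<open>down\<close>. Level q + 1 carries no condition involving Z
  because products leaving it land in I_q, where all parallel elements are identified. A collapse is
  anchored at I_0, where parallel elements are equal: a pair joining two levels is pushed down to
  the bottom, and the identification then climbs back up.\<close>

definition le_R :: "('a, 'o) psg \<Rightarrow> 'a \<Rightarrow> 'a \<Rightarrow> bool" where
  "le_R S x y \<longleftrightarrow> (\<exists>a \<in> elts S. tgt S y = src S a \<and> x = y \<cdot>\<^bsub>S\<^esub> a)"

definition le_L :: "('a, 'o) psg \<Rightarrow> 'a \<Rightarrow> 'a \<Rightarrow> bool" where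
  "le_L S x y \<longleftrightarrow> (\<exists>a \<in> elts S. tgt S a = src S y \<and> x = a \<cdot>\<^bsub>S\<^esub> y)"

definition le_J :: "('a, 'o) psg \<Rightarrow> 'a \<Rightarrow> 'a \<Rightarrow> bool" where
  "le_J S x y \<longleftrightarrow> (\<exists>a \<in> elts S. \<exists>b \<in> elts S. tgt S a = src S y \<and> tgt S y = src S b \<and>
     x = a \<cdot>\<^bsub>S\<^esub> y \<cdot>\<^bsub>S\<^esub> b)"

lemma sub_simps [simp]:
  "elts (sub S I) = I" "objs (sub S I) = objs S" "src (sub S I) = src S"
  "tgt (sub S I) = tgt S" "mul (sub S I) = mul S" "sub (sub S I) K = sub S K"
  "sub S (elts S) = S" "parallel (sub S I) = parallel S" "nabla (sub S I) X = nabla S X"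
  by (auto simp: sub_def parallel_def nabla_def fun_eq_iff)

locale regular_psg = partial_semigroup +
  assumes reg: "x \<in> elts S \<Longrightarrow> regular_elt S x"
begin

declare src_closed [simp] tgt_closed [simp] mul_closed [simp] src_mul [simp] tgt_mul [simp]

lemma obtain_inverse:
  assumes "x \<in> elts S"
  obtains a where "a \<in> elts S" "tgt S x = src S a" "tgt S a = src S x" "x \<cdot> (a \<cdot> x) = x"
    "x \<cdot> a \<cdot> x = x"
  using reg[OF assms] assms unfolding regular_elt_def by (metis mul_assoc)

text \<open>The equation x = x (a x) replaces the adjoined identity. Reflexivity is what makes
  preorders with multipliers in \<open>S\<close> agree with inclusion of principal ideals in
  S^1.\<close>

lemma le_R_refl: "x \<in> elts S \<Longrightarrow> le_R S x x"
  unfolding le_R_def by (metis obtain_inverse mul_closed src_mul)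

lemma le_L_refl: "x \<in> elts S \<Longrightarrow> le_L S x x"
  unfolding le_L_def by (metis obtain_inverse mul_closed tgt_mul)

lemma le_R_elts: "le_R S x y \<Longrightarrow> y \<in> elts S \<Longrightarrow> x \<in> elts S \<and> src S x = src S y"
  by (auto simp: le_R_def)

lemma le_L_elts: "le_L S x y \<Longrightarrow> y \<in> elts S \<Longrightarrow> x \<in> elts S \<and> tgt S x = tgt S y"
  by (auto simp: le_L_def)

lemma le_J_elts: "le_J S x y \<Longrightarrow> y \<in> elts S \<Longrightarrow> x \<in> elts S"
  by (auto simp: le_J_def)

lemma le_R_trans: "le_R S x y \<Longrightarrow> le_R S y z \<Longrightarrow> z \<in> elts S \<Longrightarrow> le_R S x z"
  unfolding le_R_def by clarsimp (metis mul_assoc mul_closed src_mul)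

lemma le_L_trans:
  assumes "le_L S x y" "le_L S y z" "z \<in> elts S"
  shows "le_L S x z"
proof -
  obtain a b where ab: "a \<in> elts S" "b \<in> elts S" "tgt S a = src S y" "tgt S b = src S z"
    "x = a \<cdot> y" "y = b \<cdot> z"
    using assms unfolding le_L_def by blast
  then have "x = (a \<cdot> b) \<cdot> z" "a \<cdot> b \<in> elts S" "tgt S (a \<cdot> b) = src S z"
    using assms(3) by (simp_all add: mul_assoc)
  then show ?thesis unfolding le_L_def by blast
qed

lemma le_R_mul: "x \<in> elts S \<Longrightarrow> a \<in> elts S \<Longrightarrow> tgt S x = src S a \<Longrightarrow> le_R S (x \<cdot> a) x"
  by (auto simp: le_R_def)

lemma le_L_mul: "x \<in> elts S \<Longrightarrow> a \<in> elts S \<Longrightarrow> tgt S a = src S x \<Longrightarrow> le_L S (a \<cdot> x) x"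
  by (auto simp: le_L_def)

lemma le_J_iff:
  assumes "y \<in> elts S"
  shows "le_J S x y \<longleftrightarrow> (\<exists>z. le_L S z y \<and> le_R S x z)"
proof
  assume "le_J S x y"
  then show "\<exists>z. le_L S z y \<and> le_R S x z"
    using assms unfolding le_J_def le_L_def le_R_def by (metis tgt_mul)
next
  assume "\<exists>z. le_L S z y \<and> le_R S x z"
  then show "le_J S x y"
    using assms unfolding le_J_def le_L_def le_R_def by (metis tgt_mul)
qed

lemma le_R_imp_J: "le_R S x y \<Longrightarrow> y \<in> elts S \<Longrightarrow> le_J S x y"
  using le_J_iff le_L_refl by blast

lemma le_L_imp_J: "le_L S x y \<Longrightarrow> y \<in> elts S \<Longrightarrow> le_J S x y"
  using le_J_iff le_R_refl le_L_elts by blast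

lemma le_R_left_mul:
  assumes "le_R S x y" "y \<in> elts S" "a \<in> elts S" "tgt S a = src S y"
  shows "le_R S (a \<cdot> x) (a \<cdot> y)"
  using assms unfolding le_R_def by (auto simp: mul_assoc)

lemma le_L_right_mul:
  assumes "le_L S x y" "y \<in> elts S" "a \<in> elts S" "tgt S y = src S a"
  shows "le_L S (x \<cdot> a) (y \<cdot> a)"
  using assms unfolding le_L_def by (auto simp: mul_assoc)

lemma le_J_trans:
  assumes "le_J S x y" "le_J S y z" "z \<in> elts S"
  shows "le_J S x z"
proof -
  have y: "y \<in> elts S" using assms le_J_elts by blast
  obtain a b where ab: "a \<in> elts S" "b \<in> elts S" "tgt S a = src S y" "tgt S y = src S b"
    "x = a \<cdot> y \<cdot> b"
    using assms(1) unfolding le_J_def by blast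
  obtain c d where cd: "c \<in> elts S" "d \<in> elts S" "tgt S c = src S z" "tgt S z = src S d"
    "y = c \<cdot> z \<cdot> d"
    using assms(2) unfolding le_J_def by blast
  have "x = (a \<cdot> c) \<cdot> z \<cdot> (d \<cdot> b)" using ab cd assms(3) by (simp add: mul_assoc)
  moreover have "a \<cdot> c \<in> elts S" "d \<cdot> b \<in> elts S" "tgt S (a \<cdot> c) = src S z"
    "tgt S z = src S (d \<cdot> b)"
    using ab cd assms(3) by simp_all
  ultimately show ?thesis unfolding le_J_def by blast
qed

lemma le_J_refl: "x \<in> elts S \<Longrightarrow> le_J S x x"
  using le_R_imp_J le_R_refl by blast

section \<open>Principal ideals and Green's relations in terms of the preorders\<close>

lemma right_principal_eq:
  assumes "x \<in> elts S"
  shows "right_principal S x = Inl ` {y. le_R S y x}" (is "?l = ?r")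
proof
  show "?l \<subseteq> ?r"
  proof
    fix w assume "w \<in> ?l"
    then obtain b where b: "b \<in> elts (adjoin1 S)" "tgt S x = src (adjoin1 S) b"
      "w = Inl x \<cdot>\<^bsub>adjoin1 S\<^esub> b" unfolding right_principal_def by blast
    then show "w \<in> ?r" using assms le_R_refl le_R_mul by (cases b) auto
  qed
  show "?r \<subseteq> ?l"
    unfolding right_principal_def le_R_def
    by clarify (metis adjoin1_simps(2) adjoin1_simps(6) adjoin1_simps(9))
qed

lemma left_principal_eq:
  assumes "x \<in> elts S"
  shows "left_principal S x = Inl ` {y. le_L S y x}" (is "?l = ?r")
proof
  show "?l \<subseteq> ?r"
  proof
    fix w assume "w \<in> ?l"
    then obtain b where b: "b \<in> elts (adjoin1 S)" "tgt (adjoin1 S) b = src S x"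
      "w = b \<cdot>\<^bsub>adjoin1 S\<^esub> Inl x" unfolding left_principal_def by blast
    then show "w \<in> ?r" using assms le_L_refl le_L_mul by (cases b) auto
  qed
  show "?r \<subseteq> ?l"
    unfolding left_principal_def le_L_def
    by clarify (metis adjoin1_simps(4) adjoin1_simps(6) adjoin1_simps(9))
qed

lemma in_principal_iff:
  assumes "y \<in> elts S"
  shows "Inl x \<in> principal S y \<longleftrightarrow> le_J S x y"
proof
  assume "Inl x \<in> principal S y"
  then obtain a b where ab: "a \<in> elts (adjoin1 S)" "b \<in> elts (adjoin1 S)"
     "tgt (adjoin1 S) a = src S y" "tgt S y = src (adjoin1 S) b"
     "Inl x = a \<cdot>\<^bsub>adjoin1 S\<^esub> Inl y \<cdot>\<^bsub>adjoin1 S\<^esub> b"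
    unfolding principal_def by blast
  obtain z where z: "Inl z = a \<cdot>\<^bsub>adjoin1 S\<^esub> Inl y" "le_L S z y"
    using ab assms le_L_refl le_L_mul by (cases a) auto
  then have "z \<in> elts S" "tgt S z = tgt S y" using le_L_elts assms by auto
  then have "le_R S x z"
    using ab(2,4,5) z(1)[symmetric] le_R_refl le_R_mul by (cases b) auto
  then show "le_J S x y" using le_J_iff assms z by blast
next
  assume "le_J S x y"
  then show "Inl x \<in> principal S y"
    unfolding principal_def le_J_def
    by clarify (metis (no_types, lifting) adjoin1_simps(2,4,6,9))
qed

lemma green_R_iff: "(x, y) \<in> green_R S \<longleftrightarrow> x \<in> elts S \<and> y \<in> elts S \<and> le_R S x y \<and> le_R S y x"
proof -
  have "right_principal S x = right_principal S y \<longleftrightarrow> le_R S x y \<and> le_R S y x"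
    if "x \<in> elts S" "y \<in> elts S"
    using that le_R_refl le_R_trans
    by (simp add: right_principal_eq inj_image_eq_iff set_eq_iff) blast
  then show ?thesis by (auto simp: green_R_def)
qed

lemma green_L_iff: "(x, y) \<in> green_L S \<longleftrightarrow> x \<in> elts S \<and> y \<in> elts S \<and> le_L S x y \<and> le_L S y x"
proof -
  have "left_principal S x = left_principal S y \<longleftrightarrow> le_L S x y \<and> le_L S y x"
    if "x \<in> elts S" "y \<in> elts S"
    using that le_L_refl le_L_trans
    by (simp add: left_principal_eq inj_image_eq_iff set_eq_iff) blast
  then show ?thesis by (auto simp: green_L_def)
qed

lemma green_J_le_iff:
  "(x, y) \<in> green_J S \<longleftrightarrow> x \<in> elts S \<and> y \<in> elts S \<and> le_J S x y \<and> le_J S y x"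
proof -
  have "(x, y) \<in> green_J S \<Longrightarrow> x \<in> elts S \<and> y \<in> elts S" by (auto simp: green_J_def)
  then show ?thesis using green_J_iff in_principal_iff by blast
qed

lemma green_H_iff: "(x, y) \<in> green_H S \<longleftrightarrow> x \<in> elts S \<and> y \<in> elts S \<and>
    le_R S x y \<and> le_R S y x \<and> le_L S x y \<and> le_L S y x"
  by (auto simp: green_H_def green_R_iff green_L_iff)

lemma green_H_parallel: "(x, y) \<in> green_H S \<Longrightarrow> parallel S x y"
  by (auto simp: green_H_iff parallel_def dest: le_R_elts le_L_elts)

lemma green_H_sym: "(x, y) \<in> green_H S \<Longrightarrow> (y, x) \<in> green_H S"
  by (auto simp: green_H_iff)

lemma green_H_trans: "(x, y) \<in> green_H S \<Longrightarrow> (y, z) \<in> green_H S \<Longrightarrow> (x, z) \<in> green_H S"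
  by (auto simp: green_H_iff intro: le_R_trans le_L_trans)

lemma green_H_refl: "x \<in> elts S \<Longrightarrow> (x, x) \<in> green_H S"
  by (auto simp: green_H_iff intro: le_R_refl le_L_refl)

lemma green_H_imp_J: "(x, y) \<in> green_H S \<Longrightarrow> (x, y) \<in> green_J S"
  by (auto simp: green_H_iff green_J_le_iff intro: le_R_imp_J)

text \<open>Take f = x a with x a x = x; then f (x b) = x b. Since f lies R-below x, it belongs to
  every ideal containing x, and this is how multipliers from \<open>S\<close> are traded for
  multipliers from an ideal.\<close>

lemma obtain_left_identity:
  assumes "x \<in> elts S"
  obtains f where "f \<in> elts S" "tgt S f = src S x" "src S f = src S x" "le_R S f x"
    "\<And>y. le_R S y x \<Longrightarrow> f \<cdot> y = y"
proof -
  obtain a where a: "a \<in> elts S" "tgt S x = src S a" "tgt S a = src S x" "x \<cdot> a \<cdot> x = x"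
    using obtain_inverse[OF assms] by metis
  show thesis
  proof (rule that[of "x \<cdot> a"])
    fix y assume "le_R S y x"
    then obtain b where b: "b \<in> elts S" "tgt S x = src S b" "y = x \<cdot> b"
      unfolding le_R_def by blast
    have "x \<cdot> a \<cdot> (x \<cdot> b) = (x \<cdot> a \<cdot> x) \<cdot> b" using a(1-3) b(1,2) assms by (simp add: mul_assoc)
    then show "x \<cdot> a \<cdot> y = y" using a b by simp
  qed (use a assms le_R_mul in auto)
qed

lemma obtain_right_identity:
  assumes "x \<in> elts S"
  obtains f where "f \<in> elts S" "src S f = tgt S x" "tgt S f = tgt S x" "le_L S f x"
    "\<And>y. le_L S y x \<Longrightarrow> y \<cdot> f = y"
proof -
  obtain a where a: "a \<in> elts S" "tgt S x = src S a" "tgt S a = src S x" "x \<cdot> a \<cdot> x = x"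
    using obtain_inverse[OF assms] by metis
  show thesis
  proof (rule that[of "a \<cdot> x"])
    fix y assume "le_L S y x"
    then obtain b where b: "b \<in> elts S" "tgt S b = src S x" "y = b \<cdot> x"
      unfolding le_L_def by blast
    have "(b \<cdot> x) \<cdot> (a \<cdot> x) = b \<cdot> (x \<cdot> a \<cdot> x)" using a(1-3) b(1,2) assms by (simp add: mul_assoc)
    then show "y \<cdot> (a \<cdot> x) = y" using a b by simp
  qed (use a assms le_L_mul in auto)
qed

section \<open>Restriction of regularity and of Green's relations to an ideal\<close>

lemma ideal_mul:
  assumes "psg_ideal S I" "x \<in> I" "s \<in> elts S"
  shows "tgt S s = src S x \<Longrightarrow> s \<cdot> x \<in> I" "tgt S x = src S s \<Longrightarrow> x \<cdot> s \<in> I"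
  using assms unfolding psg_ideal_def by auto

lemma ideal_subset: "psg_ideal S I \<Longrightarrow> x \<in> I \<Longrightarrow> x \<in> elts S"
  unfolding psg_ideal_def by auto

lemma ideal_le_R: "psg_ideal S I \<Longrightarrow> x \<in> I \<Longrightarrow> le_R S y x \<Longrightarrow> y \<in> I"
  unfolding le_R_def using ideal_mul by blast

lemma ideal_le_L: "psg_ideal S I \<Longrightarrow> x \<in> I \<Longrightarrow> le_L S y x \<Longrightarrow> y \<in> I"
  unfolding le_L_def using ideal_mul by blast

lemma ideal_le_J: "psg_ideal S I \<Longrightarrow> x \<in> I \<Longrightarrow> le_J S y x \<Longrightarrow> y \<in> I"
  using ideal_le_R ideal_le_L le_J_iff ideal_subset by metis

text \<open>If x = x a x, then a x a is another witness of regularity, and it lies in the ideal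
  because it has x as a factor.\<close>

lemma regular_psg_sub:
  assumes I: "psg_ideal S I"
  shows "regular_psg (sub S I)"
proof
  fix x y z
  show "x \<in> elts (sub S I) \<Longrightarrow> src (sub S I) x \<in> objs (sub S I)"
    "x \<in> elts (sub S I) \<Longrightarrow> tgt (sub S I) x \<in> objs (sub S I)"
    using ideal_subset[OF I] by auto
  show "regular_elt (sub S I) x" if "x \<in> elts (sub S I)"
  proof -
    have xI: "x \<in> I" "x \<in> elts S" using that ideal_subset[OF I] by auto
    obtain a where a: "a \<in> elts S" "tgt S x = src S a" "tgt S a = src S x" "x \<cdot> (a \<cdot> x) = x"
      "x \<cdot> a \<cdot> x = x" using obtain_inverse[OF xI(2)] by metis
    have 1: "a \<cdot> x \<cdot> a \<in> I" using ideal_mul[OF I] a xI by simp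
    have "x \<cdot> (a \<cdot> x \<cdot> a) \<cdot> x = (x \<cdot> a \<cdot> x) \<cdot> a \<cdot> x" using a(1-3) xI by (simp add: mul_assoc)
    then have "x = x \<cdot> (a \<cdot> x \<cdot> a) \<cdot> x" using a by simp
    then show ?thesis using 1 a xI unfolding regular_elt_def
      by (intro bexI[of _ "a \<cdot> x \<cdot> a"]) auto
  qed
qed (use ideal_subset[OF I] ideal_mul[OF I] mul_assoc in auto)

text \<open>For the direction from \<open>S\<close> to the ideal, insert a right identity f of y: y
  a = y (f a), and f a is in the ideal because f is L-below y.\<close>

lemma le_R_sub:
  assumes "psg_ideal S I" "y \<in> I"
  shows "le_R (sub S I) x y \<longleftrightarrow> le_R S x y"
proof
  assume "le_R (sub S I) x y"
  then show "le_R S x y" using ideal_subset[OF assms(1)] unfolding le_R_def by auto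
next
  assume "le_R S x y"
  then obtain a where a: "a \<in> elts S" "tgt S y = src S a" "x = y \<cdot> a" unfolding le_R_def by blast
  have y: "y \<in> elts S" using assms ideal_subset by blast
  obtain f where f: "f \<in> elts S" "src S f = tgt S y" "tgt S f = tgt S y" "le_L S f y"
    "\<And>z. le_L S z y \<Longrightarrow> z \<cdot> f = z" using obtain_right_identity[OF y] by metis
  have "f \<in> I" using ideal_le_L assms f by blast
  then have "f \<cdot> a \<in> I" using ideal_mul assms a f by auto
  moreover have "y \<cdot> (f \<cdot> a) = x"
    using a f y le_L_refl[OF y] by (simp add: mul_assoc[symmetric])
  ultimately show "le_R (sub S I) x y" unfolding le_R_def using a f
    by (intro bexI[of _ "f \<cdot> a"]) auto
qed

lemma le_L_sub:
  assumes "psg_ideal S I" "y \<in> I"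
  shows "le_L (sub S I) x y \<longleftrightarrow> le_L S x y"
proof
  assume "le_L (sub S I) x y"
  then show "le_L S x y" using ideal_subset[OF assms(1)] unfolding le_L_def by auto
next
  assume "le_L S x y"
  then obtain a where a: "a \<in> elts S" "tgt S a = src S y" "x = a \<cdot> y" unfolding le_L_def by blast
  have y: "y \<in> elts S" using assms ideal_subset by blast
  obtain f where f: "f \<in> elts S" "tgt S f = src S y" "src S f = src S y" "le_R S f y"
    "\<And>z. le_R S z y \<Longrightarrow> f \<cdot> z = z" using obtain_left_identity[OF y] by metis
  have "f \<in> I" using ideal_le_R assms f by blast
  then have "a \<cdot> f \<in> I" using ideal_mul assms a f by auto
  moreover have "(a \<cdot> f) \<cdot> y = x"
    using a f y le_R_refl[OF y] by (simp add: mul_assoc)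
  ultimately show "le_L (sub S I) x y" unfolding le_L_def using a f
    by (intro bexI[of _ "a \<cdot> f"]) auto
qed

lemma le_J_sub:
  assumes I: "psg_ideal S I" and y: "y \<in> I"
  shows "le_J (sub S I) x y \<longleftrightarrow> le_J S x y"
proof -
  interpret T: regular_psg "sub S I" using regular_psg_sub[OF I] .
  show ?thesis
    using T.le_J_iff[of y x] le_J_iff[of y x] ideal_subset[OF I y] y le_L_sub[OF I y]
      le_R_sub[OF I] ideal_le_L[OF I y] by auto
qed

lemma green_H_sub:
  assumes I: "psg_ideal S I"
  shows "(x, y) \<in> green_H (sub S I) \<longleftrightarrow> x \<in> I \<and> y \<in> I \<and> (x, y) \<in> green_H S"
proof -
  interpret T: regular_psg "sub S I" using regular_psg_sub[OF I] .
  show ?thesis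
    using ideal_subset[OF I] by (auto simp: T.green_H_iff green_H_iff le_R_sub[OF I] le_L_sub[OF I])
qed

lemma green_J_sub:
  assumes I: "psg_ideal S I"
  shows "(x, y) \<in> green_J (sub S I) \<longleftrightarrow> x \<in> I \<and> y \<in> I \<and> (x, y) \<in> green_J S"
proof -
  interpret T: regular_psg "sub S I" using regular_psg_sub[OF I] .
  show ?thesis
    using ideal_subset[OF I] by (auto simp: T.green_J_le_iff green_J_le_iff le_J_sub[OF I])
qed

end

section \<open>The relations \<open>\<nu>\<^sub>N\<close>\<close>

locale stable_psg = regular_psg +
  assumes stable_classes: "J \<in> J_classes S \<Longrightarrow> stable S J"
begin

lemma stableD:
  assumes "x \<in> elts S"
  shows "stable S (green_J S `` {x})" "x \<in> green_J S `` {x}"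
  using assms stable_classes[OF quotientI] equiv_class_self[OF equiv_green_J] by auto

text \<open>The product x a is always J-below x, so the one inequality assumed already gives
  J-equivalence, and stability applies.\<close>

lemma stable_R:
  assumes "x \<in> elts S" "a \<in> elts S" "tgt S x = src S a" "le_J S x (x \<cdot> a)"
  shows "le_R S x (x \<cdot> a)"
proof -
  have "(x, x \<cdot> a) \<in> green_J S"
    using assms by (auto simp: green_J_le_iff intro: le_R_imp_J le_R_mul)
  then have "(x, x \<cdot> a) \<in> green_R S"
    using stableD[of x] assms unfolding stable_def by blast
  then show ?thesis by (simp add: green_R_iff)
qed

lemma stable_L:
  assumes "x \<in> elts S" "a \<in> elts S" "tgt S a = src S x" "le_J S x (a \<cdot> x)"
  shows "le_L S x (a \<cdot> x)"
proof -
  have "(x, a \<cdot> x) \<in> green_J S"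
    using assms by (auto simp: green_J_le_iff intro: le_L_imp_J le_L_mul)
  then have "(x, a \<cdot> x) \<in> green_L S"
    using stableD[of x] assms unfolding stable_def by blast
  then show ?thesis by (simp add: green_L_iff)
qed

end

text \<open>For an idempotent \<open>e \<J> u\<close>, these are witnesses \<open>u \<R> a \<L> e \<R> b \<L> u\<close> together with
  the inverse translations \<open>c\<close> and \<open>d\<close>.\<close>

definition factors :: "('a, 'o) psg \<Rightarrow> 'a \<Rightarrow> 'a \<Rightarrow> 'a \<Rightarrow> 'a \<Rightarrow> 'a \<Rightarrow> 'a \<Rightarrow> bool" where
  "factors S e u a b c d \<longleftrightarrow> {a, b, c, d} \<subseteq> elts S \<and>
     tgt S a = src S e \<and> src S b = tgt S e \<and> src S c = src S e \<and> tgt S c = src S u \<and>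
     src S d = tgt S u \<and> tgt S d = tgt S e \<and> src S a = src S u \<and> tgt S b = tgt S u \<and>
     a \<cdot>\<^bsub>S\<^esub> e = a \<and> e \<cdot>\<^bsub>S\<^esub> b = b \<and> e \<cdot>\<^bsub>S\<^esub> c = c \<and> d \<cdot>\<^bsub>S\<^esub> e = d \<and>
     a \<cdot>\<^bsub>S\<^esub> b = u \<and> c \<cdot>\<^bsub>S\<^esub> a = e \<and> b \<cdot>\<^bsub>S\<^esub> d = e"

section \<open>Group H-classes and Green's lemma in coordinates\<close>

locale group_class = stable_psg +
  fixes G :: "'a set"
  assumes group_H: "group_H_class S G"
begin

abbreviation e :: 'a where "e \<equiv> \<one>\<^bsub>class_group S G\<^esub>"

abbreviation D :: "'a set" where "D \<equiv> green_J S `` {e}"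

lemma class_group_simps [simp]:
  "carrier (class_group S G) = G" "mult (class_group S G) = mul S"
  by (simp_all add: class_group_def)

lemma is_group: "group (class_group S G)"
  using group_H by (simp add: group_H_class_def)

lemma e_G [simp]: "e \<in> G"
  using group.is_monoid[OF is_group] monoid.one_closed by fastforce

lemma e_mul [simp]: "x \<in> G \<Longrightarrow> e \<cdot> x = x" "x \<in> G \<Longrightarrow> x \<cdot> e = x"
  using group.is_monoid[OF is_group] monoid.l_one monoid.r_one by fastforce+

lemma G_iff: "x \<in> G \<longleftrightarrow> (e, x) \<in> green_H S"
proof -
  obtain g where "G = green_H S `` {g}"
    using group_H unfolding group_H_class_def quotient_def by blast
  then show ?thesis
    using e_G by (auto intro: green_H_sym green_H_trans)
qed

lemma G_elts [simp]: "x \<in> G \<Longrightarrow> x \<in> elts S"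
  by (simp add: G_iff green_H_iff)

lemma tgt_e [simp]: "tgt S e = src S e"
  using group_H e_G unfolding group_H_class_def by blast

lemma G_src: "x \<in> G \<Longrightarrow> src S x = src S e" "x \<in> G \<Longrightarrow> tgt S x = src S e"
  using green_H_parallel[of e x] tgt_e unfolding G_iff parallel_def by metis+

lemma G_inverse:
  assumes "x \<in> G"
  obtains y where "y \<in> G" "x \<cdot> y = e" "y \<cdot> x = e"
  using group.r_inv[OF is_group, of x] group.l_inv[OF is_group, of x]
    group.inv_closed[OF is_group, of x] assms that by simp

lemma G_mul: "x \<in> G \<Longrightarrow> y \<in> G \<Longrightarrow> x \<cdot> y \<in> G"
  using monoid.m_closed[OF group.is_monoid[OF is_group], of x y] by simp

text \<open>Inverses and conjugates are expressed by equations x y = \<open>e\<close>, so that the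
  later computations with \<open>nu\<close> take place in \<open>S\<close> without the inverse
  operation of \<open>class_group\<close>.\<close>

lemma normal_facts:
  assumes "N \<lhd> class_group S G"
  shows "N \<subseteq> G" "e \<in> N" "\<And>x y. x \<in> N \<Longrightarrow> y \<in> N \<Longrightarrow> x \<cdot> y \<in> N"
    "\<And>x y. x \<in> N \<Longrightarrow> y \<in> G \<Longrightarrow> x \<cdot> y = e \<Longrightarrow> y \<in> N"
    "\<And>x y z. x \<in> G \<Longrightarrow> y \<in> G \<Longrightarrow> x \<cdot> y = e \<Longrightarrow> z \<in> N \<Longrightarrow> x \<cdot> z \<cdot> y \<in> N"
proof -
  have sg: "subgroup N (class_group S G)" using assms by (simp add: normal_def)
  show "N \<subseteq> G" "e \<in> N" "\<And>x y. x \<in> N \<Longrightarrow> y \<in> N \<Longrightarrow> x \<cdot> y \<in> N"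
    using subgroup.subset[OF sg] subgroup.one_closed[OF sg] subgroup.m_closed[OF sg] by auto
  have inv: "inv\<^bsub>class_group S G\<^esub> x = y" if "x \<in> G" "y \<in> G" "x \<cdot> y = e" for x y
  proof -
    interpret group "class_group S G" by (rule is_group)
    have "inv\<^bsub>class_group S G\<^esub> x \<cdot> (x \<cdot> y) = y"
      using that inv_closed[of x] l_inv[of x] m_assoc[of "inv\<^bsub>class_group S G\<^esub> x" x y] by simp
    then show ?thesis using that inv_closed[of x] by simp
  qed
  show "y \<in> N" if "x \<in> N" "y \<in> G" "x \<cdot> y = e" for x y
    using inv[of x y] subgroup.m_inv_closed[OF sg, of x] that \<open>N \<subseteq> G\<close> by auto
  show "x \<cdot> z \<cdot> y \<in> N" if "x \<in> G" "y \<in> G" "x \<cdot> y = e" "z \<in> N" for x y z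
    using inv[of x y] normal.inv_op_closed2[OF assms, of x z] that by simp
qed

text \<open>Write u = a0 e b0 and split it as a = a0 e, b = e b0. Both a and b are J-above u, hence
  J-above e; stability upgrades this to e L a and e R b, and the multipliers witnessing these
  relations lead back to e.\<close>

lemma obtain_factors:
  assumes "u \<in> D"
  obtains a b c d where "factors S e u a b c d"
proof -
  have u: "u \<in> elts S" "le_J S u e" "le_J S e u"
    using assms green_J_le_iff[of e u] by simp_all
  obtain a0 b0 where ab0: "a0 \<in> elts S" "b0 \<in> elts S" "tgt S a0 = src S e" "src S e = src S b0"
    "u = a0 \<cdot> e \<cdot> b0"
    using u(2) unfolding le_J_def tgt_e by blast
  define a b where ab_def: "a = a0 \<cdot> e" "b = e \<cdot> b0"
  have ab: "a \<in> elts S" "b \<in> elts S" "tgt S a = src S e" "src S b = src S e"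
    using ab0(1-4) by (simp_all add: ab_def)
  have e2: "a \<cdot> e = a" using ab0(1-4) by (simp add: ab_def mul_assoc)
  have e3: "e \<cdot> b = b" using ab0(1-4) by (simp add: ab_def mul_assoc[symmetric])
  have "a \<cdot> b = (a \<cdot> e) \<cdot> b0" using ab0(1-4) ab by (simp add: ab_def(2) mul_assoc)
  then have u_eq: "a \<cdot> b = u" using e2 ab0(5) by (simp add: ab_def)
  have "le_J S u a" "le_J S u b"
    using ab u_eq le_R_imp_J[OF le_R_mul[of a b]] le_L_imp_J[OF le_L_mul[of b a]] by auto
  then have J: "le_J S e a" "le_J S e b"
    using u(3) le_J_trans ab by blast+
  have "le_L S e a" using stable_L[of e a0] J(1) ab0(1-4) unfolding ab_def by simp
  then obtain c0 where c0: "c0 \<in> elts S" "tgt S c0 = src S a" "c0 \<cdot> a = e"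
    unfolding le_L_def by metis
  have "le_R S e b" using stable_R[of e b0] J(2) ab0(1-4) unfolding ab_def by simp
  then obtain d0 where d0: "d0 \<in> elts S" "tgt S b = src S d0" "b \<cdot> d0 = e"
    unfolding le_R_def by metis
  have sc: "src S c0 = src S e" "tgt S d0 = src S e"
    using src_mul[of c0 a] tgt_mul[of b d0] c0 d0 ab by simp_all
  have ty: "src S a = src S u" "tgt S b = tgt S u"
    using ab unfolding u_eq[symmetric] by simp_all
  have ee: "e \<cdot> e = e" by simp
  \<comment> \<open>The multipliers c0 and d0 are padded with \<open>e\<close> to meet the
    normalisation e c = c and d e = d; this keeps c a = e and b d = e.\<close>
  have 1: "e \<cdot> (e \<cdot> c0) = e \<cdot> c0"
    using c0(1) sc by (simp only: mul_assoc[symmetric] ee G_elts e_G tgt_e)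
  have 2: "d0 \<cdot> e \<cdot> e = d0 \<cdot> e"
    using d0(1) sc by (simp only: mul_assoc ee G_elts e_G tgt_e)
  have 3: "e \<cdot> c0 \<cdot> a = e" using c0 sc ab(1) by (simp add: mul_assoc)
  have 4: "b \<cdot> (d0 \<cdot> e) = e" using d0 sc ab(2) by (simp add: mul_assoc[symmetric])
  have "factors S e u a b (e \<cdot> c0) (d0 \<cdot> e)"
    unfolding factors_def using 1 2 3 4 ab e2 e3 u_eq c0(1,2) d0(1,2) sc ty by simp
  then show thesis using that by blast
qed

text \<open>This puts c and d into every ideal containing \<open>e\<close>, so that a congruence on
  such an ideal may be multiplied by them. The reason is c = e c together with c a = e, and dually
  for d.\<close>

lemma factors_mem_D:
  assumes "factors S e u a b c d"
  shows "c \<in> D" "d \<in> D"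
proof -
  have el: "a \<in> elts S" "b \<in> elts S" "c \<in> elts S" "d \<in> elts S"
    and ty: "tgt S c = src S a" "tgt S b = src S d" "src S c = src S e" "tgt S d = src S e"
    and eq: "e \<cdot> c = c" "d \<cdot> e = d" "c \<cdot> a = e" "b \<cdot> d = e"
    using assms by (simp_all add: factors_def)
  have "le_R S c e" "le_J S e c" "le_L S d e" "le_J S e d"
    using el ty le_R_mul[of e c] le_L_mul[of e d] le_R_imp_J[OF le_R_mul[of c a]]
      le_L_imp_J[OF le_L_mul[of d b]] by (simp_all add: eq)
  then show "c \<in> D" "d \<in> D"
    using el by (simp_all add: green_J_le_iff le_R_imp_J le_L_imp_J)
qed

lemma factors_base:
  assumes "factors S e u a b c d"
  shows "c \<cdot> u \<cdot> d = e"
proof -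
  have el: "a \<in> elts S" "b \<in> elts S" "c \<in> elts S" "d \<in> elts S"
    and ty: "tgt S c = src S a" "tgt S b = src S d" "tgt S a = src S b"
    and eq: "a \<cdot> b = u" "c \<cdot> a = e" "b \<cdot> d = e"
    using assms by (simp_all add: factors_def)
  have "c \<cdot> (a \<cdot> b) \<cdot> d = (c \<cdot> a) \<cdot> (b \<cdot> d)" using el ty by (simp add: mul_assoc)
  then show ?thesis by (simp add: eq)
qed

text \<open>Green's lemma: v is sent to its coordinate c v d in \<open>G\<close>, and x to a x b
  recovers it. The product a c fixes u, hence also v = u s; likewise d b fixes u, hence also v = t
  u.\<close>

lemma factors_H:
  assumes f: "factors S e u a b c d" and uv: "(u, v) \<in> green_H S"
  shows "c \<cdot> v \<cdot> d \<in> G" "a \<cdot> (c \<cdot> v \<cdot> d) \<cdot> b = v" "a \<cdot> (c \<cdot> v) = v" "v \<cdot> d \<cdot> b = v"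
proof -
  have el: "u \<in> elts S" "v \<in> elts S" "a \<in> elts S" "b \<in> elts S" "c \<in> elts S" "d \<in> elts S"
    using f uv by (auto simp: factors_def green_H_iff)
  have sv: "src S v = src S u" "tgt S v = tgt S u"
    using green_H_parallel[OF uv] by (auto simp: parallel_def)
  have ty: "tgt S a = src S e" "src S b = src S e" "src S c = src S e" "tgt S c = src S u"
     "src S d = tgt S u" "tgt S d = src S e" "src S a = src S u" "tgt S b = tgt S u"
    using f by (auto simp: factors_def)
  have eq: "a \<cdot> e = a" "e \<cdot> b = b" "e \<cdot> c = c" "d \<cdot> e = d" "u = a \<cdot> b" "c \<cdot> a = e" "b \<cdot> d = e"
    using f by (auto simp: factors_def)
  note T = el sv ty
  have acu: "a \<cdot> c \<cdot> u = u"
  proof -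
    have "a \<cdot> c \<cdot> (a \<cdot> b) = a \<cdot> (c \<cdot> a) \<cdot> b" using T by (simp add: mul_assoc)
    then show ?thesis using eq by simp
  qed
  have udb: "u \<cdot> (d \<cdot> b) = u"
  proof -
    have "a \<cdot> b \<cdot> (d \<cdot> b) = a \<cdot> ((b \<cdot> d) \<cdot> b)" using T by (simp add: mul_assoc)
    then show ?thesis using eq by simp
  qed
  obtain s where s: "s \<in> elts S" "tgt S u = src S s" "v = u \<cdot> s"
    using uv unfolding green_H_iff le_R_def by blast
  obtain t where t: "t \<in> elts S" "tgt S t = src S u" "v = t \<cdot> u"
    using uv unfolding green_H_iff le_L_def by blast
  have acv: "a \<cdot> c \<cdot> v = v"
  proof -
    have "a \<cdot> c \<cdot> (u \<cdot> s) = (a \<cdot> c \<cdot> u) \<cdot> s" using T s(1,2) by (simp add: mul_assoc)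
    then show ?thesis using acu s(3) by simp
  qed
  have vdb: "v \<cdot> (d \<cdot> b) = v"
  proof -
    have "t \<cdot> u \<cdot> (d \<cdot> b) = t \<cdot> (u \<cdot> (d \<cdot> b))" using T t(1,2) by (simp add: mul_assoc)
    then show ?thesis using udb t(3) by simp
  qed
  show "a \<cdot> (c \<cdot> v) = v" using acv T by (simp add: mul_assoc)
  show "v \<cdot> d \<cdot> b = v" using vdb T by (simp add: mul_assoc)
  have "a \<cdot> (c \<cdot> v \<cdot> d) \<cdot> b = a \<cdot> c \<cdot> v \<cdot> (d \<cdot> b)" using T by (simp add: mul_assoc)
  then show "a \<cdot> (c \<cdot> v \<cdot> d) \<cdot> b = v" using acv vdb by simp
  define x where "x = c \<cdot> v \<cdot> d"
  have x: "x \<in> elts S" "src S x = src S e" "tgt S x = src S e"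
    using T by (simp_all add: x_def)
  have ex: "e \<cdot> x = x"
  proof -
    have "e \<cdot> (c \<cdot> v \<cdot> d) = (e \<cdot> c) \<cdot> v \<cdot> d" using T by (simp add: mul_assoc)
    then show ?thesis using eq by (simp add: x_def)
  qed
  have xe: "x \<cdot> e = x"
  proof -
    have "c \<cdot> v \<cdot> d \<cdot> e = c \<cdot> v \<cdot> (d \<cdot> e)" using T by (simp add: mul_assoc)
    then show ?thesis using eq by (simp add: x_def)
  qed
  have 1: "le_R S x e" using ex x le_R_mul[of e x] by simp
  have 2: "le_L S x e" using xe x le_L_mul[of e x] by simp
  \<comment> \<open>The multiplier s' takes v back to u, so b s' d takes x back to c u d =
    \<open>e\<close>. The element t' below does the same from the left.\<close>
  obtain s' where s': "s' \<in> elts S" "tgt S v = src S s'" "u = v \<cdot> s'"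
    using uv unfolding green_H_iff le_R_def by blast
  have ts': "tgt S s' = tgt S u" using tgt_mul[of v s'] s'(1,2) el(2) unfolding s'(3)[symmetric] by simp
  have "x \<cdot> (b \<cdot> s' \<cdot> d) = c \<cdot> (v \<cdot> (d \<cdot> b)) \<cdot> s' \<cdot> d"
    using T s'(1,2) ts' by (simp add: x_def mul_assoc)
  also have "\<dots> = c \<cdot> (v \<cdot> s') \<cdot> d" unfolding vdb using T s'(1,2) by (simp add: mul_assoc)
  also have "\<dots> = e" unfolding s'(3)[symmetric] by (rule factors_base[OF f])
  finally have 3: "le_R S e x"
    using le_R_mul[of x "b \<cdot> s' \<cdot> d"] x T s'(1,2) ts' by simp
  obtain t' where t': "t' \<in> elts S" "tgt S t' = src S v" "u = t' \<cdot> v"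
    using uv unfolding green_H_iff le_L_def by blast
  have st': "src S t' = src S u" using src_mul[of t' v] t'(1,2) el(2) unfolding t'(3)[symmetric] by simp
  have "(c \<cdot> t' \<cdot> a) \<cdot> x = c \<cdot> t' \<cdot> (a \<cdot> c \<cdot> v) \<cdot> d"
    using T t'(1,2) st' by (simp add: x_def mul_assoc)
  also have "\<dots> = c \<cdot> (t' \<cdot> v) \<cdot> d" unfolding acv using T t'(1,2) st' by (simp add: mul_assoc)
  also have "\<dots> = e" unfolding t'(3)[symmetric] by (rule factors_base[OF f])
  finally have 4: "le_L S e x"
    using le_L_mul[of x "c \<cdot> t' \<cdot> a"] x T t'(1,2) st' by simp
  show "c \<cdot> v \<cdot> d \<in> G"
    using 1 2 3 4 x unfolding G_iff green_H_iff x_def[symmetric] by simp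
qed

end

section \<open>The relation \<open>nu\<close> on a single level: coordinates, equivalence,
  compatibility\<close>

context group_class
begin

lemma e_elts: "e \<in> elts S" by simp

text \<open>An adjoined identity occurring as a multiplier is replaced by \<open>e\<close>, which
  acts as an identity on both sides of \<open>G\<close>.\<close>

lemma nu_iff_elts:
  assumes N: "N \<subseteq> G"
  shows "(u, v) \<in> nu S D N \<longleftrightarrow> u \<in> D \<and> v \<in> D \<and> (\<exists>x\<in>N. \<exists>y\<in>N. \<exists>a\<in>elts S. \<exists>b\<in>elts S.
    tgt S a = src S e \<and> src S b = src S e \<and> u = a \<cdot> x \<cdot> b \<and> v = a \<cdot> y \<cdot> b)"
    (is "_ \<longleftrightarrow> _ \<and> _ \<and> ?P")
proof
  assume "(u, v) \<in> nu S D N"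
  then obtain x y a' b' where D: "u \<in> D" "v \<in> D" and xy: "x \<in> N" "y \<in> N"
    and ab: "a' \<in> elts (adjoin1 S)" "b' \<in> elts (adjoin1 S)"
      "tgt (adjoin1 S) a' = src S x" "tgt S x = src (adjoin1 S) b'"
    and u: "Inl u = a' \<cdot>\<^bsub>adjoin1 S\<^esub> Inl x \<cdot>\<^bsub>adjoin1 S\<^esub> b'"
    and v: "Inl v = a' \<cdot>\<^bsub>adjoin1 S\<^esub> Inl y \<cdot>\<^bsub>adjoin1 S\<^esub> b'"
    unfolding nu_def by blast
  have G: "x \<in> G" "y \<in> G" using xy N by auto
  have ty: "src S x = src S e" "src S y = src S e" "tgt S x = src S e" "tgt S y = src S e"
    using G_src G by metis+
  obtain a where a: "a \<in> elts S" "tgt S a = src S e" "src S a = src (adjoin1 S) a'"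
    "\<And>z. z \<in> G \<Longrightarrow> a' \<cdot>\<^bsub>adjoin1 S\<^esub> Inl z = Inl (a \<cdot> z)"
  proof (cases a')
    case (Inl \<alpha>)
    then show ?thesis using that[of \<alpha>] ab ty by simp
  next
    case (Inr A)
    then show ?thesis using that[of e] ab ty by simp
  qed
  obtain b where b: "b \<in> elts S" "src S b = src S e"
    "\<And>z. z \<in> elts S \<Longrightarrow> tgt S z = src S e \<Longrightarrow> z \<cdot> e = z \<Longrightarrow>
       Inl z \<cdot>\<^bsub>adjoin1 S\<^esub> b' = Inl (z \<cdot> b)"
  proof (cases b')
    case (Inl \<beta>)
    then show ?thesis using that[of \<beta>] ab ty by simp
  next
    case (Inr A)
    then show ?thesis using that[of e] ab ty by simp
  qed
  have "a \<cdot> z \<in> elts S \<and> tgt S (a \<cdot> z) = src S e \<and> a \<cdot> z \<cdot> e = a \<cdot> z" if "z \<in> G" for z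
    using a(1,2) that G_src[OF that] by (simp add: mul_assoc)
  then have "u = a \<cdot> x \<cdot> b" "v = a \<cdot> y \<cdot> b"
    using u v a(4)[OF G(1)] a(4)[OF G(2)] b(3) G by simp_all
  then show "u \<in> D \<and> v \<in> D \<and> ?P" using D xy a b by blast
next
  assume R: "u \<in> D \<and> v \<in> D \<and> ?P"
  then obtain x y a b where xy: "x \<in> N" "y \<in> N"
    and ab: "a \<in> elts S" "b \<in> elts S" "tgt S a = src S e" "src S b = src S e"
    and uv: "u = a \<cdot> x \<cdot> b" "v = a \<cdot> y \<cdot> b" by blast
  have G: "x \<in> G" "y \<in> G" using xy N by auto
  have ty: "src S x = src S e" "src S y = src S e" "tgt S x = src S e" "tgt S y = src S e"
    using G_src G by metis+
  have "Inl a \<in> elts (adjoin1 S)" "Inl b \<in> elts (adjoin1 S)" using ab by simp_all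
  moreover have "tgt (adjoin1 S) (Inl a) = src S x" "tgt S x = src (adjoin1 S) (Inl b)"
    "tgt (adjoin1 S) (Inl a) = src S y" "tgt S y = src (adjoin1 S) (Inl b)"
    "Inl u = Inl a \<cdot>\<^bsub>adjoin1 S\<^esub> Inl x \<cdot>\<^bsub>adjoin1 S\<^esub> Inl b"
    "Inl v = Inl a \<cdot>\<^bsub>adjoin1 S\<^esub> Inl y \<cdot>\<^bsub>adjoin1 S\<^esub> Inl b"
    using ab ty uv by simp_all
  moreover have "u \<in> D" "v \<in> D" using R by blast+
  ultimately show "(u, v) \<in> nu S D N"
    unfolding nu_def using xy by blast
qed

lemma nuI:
  assumes "N \<subseteq> G" "x \<in> N" "y \<in> N" "a \<in> elts S" "b \<in> elts S" "tgt S a = src S e" "src S b = src S e"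
    "u = a \<cdot> x \<cdot> b" "v = a \<cdot> y \<cdot> b" "u \<in> D" "v \<in> D"
  shows "(u, v) \<in> nu S D N"
  unfolding nu_iff_elts[OF assms(1)] using assms(2-) by blast

text \<open>From u = a x b and v = a y b, absorb x into the left factor: u = (a x)(e b) and v = (a
  x)(z y)(e b) with z the inverse of x. The difference between u and v is then carried by the single
  element z y of \<open>N\<close>.\<close>

lemma nu_canonical:
  assumes N: "N \<lhd> class_group S G" and uv: "(u, v) \<in> nu S D N"
  obtains \<alpha> \<beta> g where "\<alpha> \<in> elts S" "\<beta> \<in> elts S" "g \<in> N" "tgt S \<alpha> = src S e" "src S \<beta> = src S e"
    "\<alpha> \<cdot> e = \<alpha>" "e \<cdot> \<beta> = \<beta>" "u = \<alpha> \<cdot> \<beta>" "v = \<alpha> \<cdot> g \<cdot> \<beta>"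
proof -
  note nf = normal_facts[OF N]
  obtain x y a b where xy: "x \<in> N" "y \<in> N"
    and ab: "a \<in> elts S" "b \<in> elts S" "tgt S a = src S e" "src S b = src S e"
    and uv': "u = a \<cdot> x \<cdot> b" "v = a \<cdot> y \<cdot> b"
    using uv nu_iff_elts[OF nf(1)] by blast
  have G: "x \<in> G" "y \<in> G" using xy nf by auto
  obtain z where z: "z \<in> G" "x \<cdot> z = e" using G_inverse[OF G(1)] by blast
  have zN: "z \<in> N" using nf(4) z xy by blast
  have ty: "src S x = src S e" "src S y = src S e" "tgt S x = src S e" "tgt S y = src S e"
    "src S z = src S e" "tgt S z = src S e"
    using G_src G z by metis+
  have el: "x \<in> elts S" "y \<in> elts S" "z \<in> elts S" using G z by auto
  note T = ab el ty
  show thesis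
  proof (rule that[of "a \<cdot> x" "e \<cdot> b" "z \<cdot> y"])
    show "z \<cdot> y \<in> N" using nf(3) zN xy by blast
    have "a \<cdot> x \<cdot> e = a \<cdot> (x \<cdot> e)" using T by (simp add: mul_assoc)
    then show xe: "a \<cdot> x \<cdot> e = a \<cdot> x" using G by simp
    have "e \<cdot> (e \<cdot> b) = (e \<cdot> e) \<cdot> b" using T by (simp add: mul_assoc[symmetric])
    then show "e \<cdot> (e \<cdot> b) = e \<cdot> b" by simp
    have "a \<cdot> x \<cdot> (e \<cdot> b) = (a \<cdot> x \<cdot> e) \<cdot> b" using T by (simp add: mul_assoc)
    then show "u = a \<cdot> x \<cdot> (e \<cdot> b)" using xe uv' by simp
    have "a \<cdot> x \<cdot> (z \<cdot> y) \<cdot> (e \<cdot> b) = a \<cdot> ((x \<cdot> z) \<cdot> (y \<cdot> e)) \<cdot> b"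
      using T by (simp add: mul_assoc)
    then show "v = a \<cdot> x \<cdot> (z \<cdot> y) \<cdot> (e \<cdot> b)" using z G uv' by simp
  qed (use T in simp_all)
qed

lemma D_iff: "u \<in> D \<longleftrightarrow> u \<in> elts S \<and> le_J S u e \<and> le_J S e u"
  using green_J_le_iff[of e u] by auto

lemma D_le_J: "u \<in> D \<Longrightarrow> x \<in> elts S \<Longrightarrow> le_J S x e \<Longrightarrow> le_J S x u"
  using le_J_trans[of x e u] D_iff[of u] by blast

text \<open>Membership in \<open>nu\<close> can be tested in any one factorisation of u.
  Independence of the choice is where normality enters: the given factorisation and the one defining
  the pair differ by an element k of \<open>G\<close>, and the coordinate c v d is the conjugate of
  g by k.\<close>

lemma nu_iff:
  assumes N: "N \<lhd> class_group S G" and f: "factors S e u a b c d" and u: "u \<in> D"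
  shows "(u, v) \<in> nu S D N \<longleftrightarrow> (u, v) \<in> green_H S \<and> c \<cdot> v \<cdot> d \<in> N"
proof
  assume R: "(u, v) \<in> green_H S \<and> c \<cdot> v \<cdot> d \<in> N"
  have "v \<in> D"
    using R u green_H_imp_J[of u v] equiv_class_eq[OF equiv_green_J, of u v]
      equiv_class_eq[OF equiv_green_J, of e u] equiv_green_J
    by (metis Image_singleton_iff)
  moreover have "u = a \<cdot> e \<cdot> b" using f by (simp add: factors_def)
  moreover have "v = a \<cdot> (c \<cdot> v \<cdot> d) \<cdot> b" using factors_H(2)[OF f] R by simp
  moreover have "tgt S a = src S e" "src S b = src S e" "a \<in> elts S" "b \<in> elts S"
    using f by (simp_all add: factors_def)
  ultimately show "(u, v) \<in> nu S D N"
    using nuI[OF normal_facts(1)[OF N]] u R normal_facts(2)[OF N] by metis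
next
  assume uv: "(u, v) \<in> nu S D N"
  note nf = normal_facts[OF N]
  have vD: "v \<in> D" using uv by (simp add: nu_def)
  obtain \<alpha> \<beta> g where ab: "\<alpha> \<in> elts S" "\<beta> \<in> elts S" "g \<in> N" "tgt S \<alpha> = src S e" "src S \<beta> = src S e"
    "\<alpha> \<cdot> e = \<alpha>" "e \<cdot> \<beta> = \<beta>" "u = \<alpha> \<cdot> \<beta>" "v = \<alpha> \<cdot> g \<cdot> \<beta>"
    by (rule nu_canonical[OF N uv])
  have g: "g \<in> G" using ab nf by auto
  have gt: "src S g = src S e" "tgt S g = src S e" "g \<in> elts S" using g G_src[OF g] by simp_all
  have "le_L S \<alpha> e" "le_R S \<beta> e"
    using ab(1-7) le_L_mul[of e \<alpha>] le_R_mul[of e \<beta>] by simp_all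
  then have "le_J S \<alpha> e" "le_J S \<beta> e"
    by (auto intro: le_L_imp_J le_R_imp_J)
  then have J: "le_J S \<alpha> u" "le_J S \<alpha> v" "le_J S \<beta> u" "le_J S \<beta> v" "le_J S e \<alpha>"
  proof -
    show "le_J S \<alpha> u" "le_J S \<alpha> v" "le_J S \<beta> u" "le_J S \<beta> v"
      using D_le_J u vD ab(1,2) \<open>le_J S \<alpha> e\<close> \<open>le_J S \<beta> e\<close> by simp_all
    have "le_J S u \<alpha>" using ab(1,2,4,5) le_R_imp_J[OF le_R_mul[of \<alpha> \<beta>]] unfolding ab(8) by simp
    then show "le_J S e \<alpha>" using le_J_trans[of e u \<alpha>] D_iff[of u] u ab(1) by blast
  qed
  have v1: "v = \<alpha> \<cdot> (g \<cdot> \<beta>)" using ab gt by (simp add: mul_assoc)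
  \<comment> \<open>Both u and v are multiples of \<alpha> on the right and of \<beta> on the left
    without leaving the level, so stability makes both R-related to \<alpha> and L-related to
    \<beta>; this yields u H v.\<close>
  have R: "le_R S \<alpha> u" "le_R S \<alpha> v" "le_R S u \<alpha>" "le_R S v \<alpha>"
    using stable_R[of \<alpha> \<beta>] stable_R[of \<alpha> "g \<cdot> \<beta>"] le_R_mul[of \<alpha> \<beta>] le_R_mul[of \<alpha> "g \<cdot> \<beta>"]
      ab(1,2,4,5,8) v1 gt J by simp_all
  have L: "le_L S \<beta> u" "le_L S \<beta> v" "le_L S u \<beta>" "le_L S v \<beta>"
    using stable_L[of \<beta> \<alpha>] stable_L[of \<beta> "\<alpha> \<cdot> g"] le_L_mul[of \<beta> \<alpha>] le_L_mul[of \<beta> "\<alpha> \<cdot> g"]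
      ab(1,2,4,5,8,9) gt J by simp_all
  have el: "u \<in> elts S" "v \<in> elts S" using u vD D_iff by blast+
  have H: "(u, v) \<in> green_H S"
    using le_R_trans[OF R(3,2)] le_R_trans[OF R(4,1)] le_L_trans[OF L(3,2)] le_L_trans[OF L(4,1)] el
    unfolding green_H_iff by blast
  have ft: "a \<in> elts S" "b \<in> elts S" "c \<in> elts S" "d \<in> elts S"
     "tgt S a = src S e" "src S b = src S e" "src S c = src S e" "tgt S c = src S u"
     "src S d = tgt S u" "tgt S d = src S e" "src S a = src S u" "tgt S b = tgt S u"
    and fe: "a \<cdot> e = a" "e \<cdot> b = b" "e \<cdot> c = c" "d \<cdot> e = d" "a \<cdot> b = u" "c \<cdot> a = e" "b \<cdot> d = e"
    using f by (simp_all add: factors_def)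
  have st: "src S \<alpha> = src S u" "tgt S \<beta> = tgt S u" using ab(1,2,4,5) unfolding ab(8) by simp_all
  \<comment> \<open>These compare u = \<alpha> \<beta> with u = a b. Since k m = c u d =
    \<open>e\<close>, m is the inverse of k once k is known to lie in \<open>G\<close>, and c v d =
    k g m.\<close>
  define k m where "k = c \<cdot> \<alpha>" and "m = \<beta> \<cdot> d"
  have kt: "k \<in> elts S" "src S k = src S e" "tgt S k = src S e"
    "m \<in> elts S" "src S m = src S e" "tgt S m = src S e"
    using ab(1,2,4,5) ft st by (simp_all add: k_def m_def)
  have km: "k \<cdot> m = e"
  proof -
    have "k \<cdot> m = c \<cdot> (\<alpha> \<cdot> \<beta>) \<cdot> d" unfolding k_def m_def using ab(1,2,4,5) ft st by (simp add: mul_assoc)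
    then show ?thesis using ab(8) factors_base[OF f] by simp
  qed
  have ek: "e \<cdot> k = k" "k \<cdot> e = k"
    unfolding k_def using ab(1,4,6) ft st fe(3)
    by (simp add: mul_assoc[symmetric], simp add: mul_assoc)
  have em: "e \<cdot> m = m"
    unfolding m_def using ab(2,5,7) ft st by (simp add: mul_assoc[symmetric])
  \<comment> \<open>The product a c fixes u, hence every element R-below u, in particular
    \<alpha>.\<close>
  have ac\<alpha>: "a \<cdot> k = \<alpha>"
  proof -
    obtain s where s: "s \<in> elts S" "tgt S u = src S s" "\<alpha> = u \<cdot> s"
      using R(1) unfolding le_R_def by blast
    have "a \<cdot> (c \<cdot> (u \<cdot> s)) = a \<cdot> (c \<cdot> u) \<cdot> s" using ft el s(1,2) by (simp add: mul_assoc)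
    then show ?thesis using factors_H(3)[OF f green_H_refl[OF el(1)]] s(3) by (simp add: k_def)
  qed
  have "le_L S e \<alpha>" using stable_L[of e \<alpha>] ab(1,4,6) J(5) by simp
  then obtain c' where c': "c' \<in> elts S" "tgt S c' = src S \<alpha>" "c' \<cdot> \<alpha> = e"
    unfolding le_L_def by metis
  have "le_R S e k" using le_R_mul[of k m] km kt by simp
  moreover have "(c' \<cdot> a) \<cdot> k = e" using ac\<alpha> c' ft kt st by (simp add: mul_assoc)
  then have "le_L S e k" using le_L_mul[of k "c' \<cdot> a"] c' ft kt st by simp
  moreover have "le_R S k e" "le_L S k e" using ek kt le_R_mul[of e k] le_L_mul[of e k] by simp_all
  ultimately have kG: "k \<in> G" using kt(1) e_elts unfolding G_iff green_H_iff by blast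
  obtain l where l: "l \<in> G" "k \<cdot> l = e" "l \<cdot> k = e" using G_inverse[OF kG] by metis
  have lt: "l \<in> elts S" "src S l = src S e" "tgt S l = src S e" using l(1) G_src[OF l(1)] by simp_all
  have "l \<cdot> (k \<cdot> m) = (l \<cdot> k) \<cdot> m" using lt kt by (simp add: mul_assoc)
  then have ml: "m = l" using km em l by simp
  have "c \<cdot> v \<cdot> d = k \<cdot> g \<cdot> m"
    unfolding k_def m_def ab(9) using ab(1,2,4,5) ft st gt by (simp add: mul_assoc)
  then have "c \<cdot> v \<cdot> d \<in> N" using nf(5)[OF kG l(1,2) ab(3)] ml by simp
  then show "(u, v) \<in> green_H S \<and> c \<cdot> v \<cdot> d \<in> N" using H by blast
qed

lemma nu_refl: 
  assumes N: "N \<lhd> class_group S G" and u: "u \<in> D" shows "(u, u) \<in> nu S D N"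
proof -
  obtain a b c d where f: "factors S e u a b c d" using obtain_factors[OF u] by metis
  show ?thesis
    using nu_iff[OF N f u] factors_base[OF f] normal_facts(2)[OF N] green_H_refl D_iff[of u] u
    by simp
qed

lemma nu_sym: "(u, v) \<in> nu S D N \<Longrightarrow> (v, u) \<in> nu S D N"
  unfolding nu_def by blast

lemma nu_H:
  assumes N: "N \<lhd> class_group S G" and uv: "(u, v) \<in> nu S D N"
  shows "(u, v) \<in> green_H S" "u \<in> D" "v \<in> D"
proof -
  show u: "u \<in> D" "v \<in> D" using uv by (simp_all add: nu_def)
  obtain a b c d where f: "factors S e u a b c d" using obtain_factors[OF u(1)] by metis
  show "(u, v) \<in> green_H S" using nu_iff[OF N f u(1)] uv by blast
qed

text \<open>With x the coordinate of v relative to u and z its inverse, a x, b, z c, d factorise v.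
  The coordinate of w relative to u is x times its coordinate relative to v, so closure of
  \<open>N\<close> under products suffices.\<close>

lemma nu_trans:
  assumes N: "N \<lhd> class_group S G" and uv: "(u, v) \<in> nu S D N" and vw: "(v, w) \<in> nu S D N"
  shows "(u, w) \<in> nu S D N"
proof -
  note nf = normal_facts[OF N]
  note H = nu_H[OF N uv] nu_H[OF N vw]
  obtain a b c d where f: "factors S e u a b c d" using obtain_factors[OF H(2)] by metis
  have ft: "a \<in> elts S" "b \<in> elts S" "c \<in> elts S" "d \<in> elts S"
     "tgt S a = src S e" "src S b = src S e" "src S c = src S e" "tgt S c = src S u"
     "src S d = tgt S u" "tgt S d = src S e" "src S a = src S u" "tgt S b = tgt S u"
    and fe: "a \<cdot> e = a" "e \<cdot> b = b" "e \<cdot> c = c" "d \<cdot> e = d" "a \<cdot> b = u" "c \<cdot> a = e" "b \<cdot> d = e"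
    using f by (simp_all add: factors_def)
  define x where "x = c \<cdot> v \<cdot> d"
  have x: "x \<in> N" "x \<in> G" using nu_iff[OF N f H(2)] uv nf by (auto simp: x_def)
  have v: "a \<cdot> x \<cdot> b = v" using factors_H(2)[OF f H(1)] by (simp add: x_def)
  obtain z where z: "z \<in> G" "x \<cdot> z = e" "z \<cdot> x = e" using G_inverse[OF x(2)] by metis
  have T: "x \<in> elts S" "z \<in> elts S" "src S x = src S e" "tgt S x = src S e"
    "src S z = src S e" "tgt S z = src S e" using x(2) z(1) G_src[OF x(2)] G_src[OF z(1)] by simp_all
  have sv: "src S v = src S u" "tgt S v = tgt S u" "src S w = src S u" "tgt S w = tgt S u"
    using green_H_parallel[OF H(1)] green_H_parallel[OF H(4)] by (auto simp: parallel_def)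
  have "z \<cdot> c \<cdot> (a \<cdot> x) = z \<cdot> (c \<cdot> a) \<cdot> x" using ft T by (simp add: mul_assoc)
  then have 1: "z \<cdot> c \<cdot> (a \<cdot> x) = e" using fe z by simp
  have 2: "a \<cdot> x \<cdot> e = a \<cdot> x" using ft T x by (simp add: mul_assoc)
  have 3: "e \<cdot> (z \<cdot> c) = z \<cdot> c" using ft T z by (simp add: mul_assoc[symmetric])
  have f': "factors S e v (a \<cdot> x) b (z \<cdot> c) d"
    unfolding factors_def using ft fe T 1 2 3 v sv by simp
  have zw: "z \<cdot> c \<cdot> w \<cdot> d \<in> N" using nu_iff[OF N f' H(3)] vw by blast
  have w: "w \<in> elts S" using H(6) D_iff by blast
  have "x \<cdot> (z \<cdot> c \<cdot> w \<cdot> d) = (x \<cdot> z) \<cdot> c \<cdot> w \<cdot> d" using T ft w sv by (simp add: mul_assoc)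
  then have "c \<cdot> w \<cdot> d \<in> N" using nf(3)[OF x(1) zw] z fe by simp
  then show ?thesis using nu_iff[OF N f H(2)] green_H_trans H by blast
qed

lemma nu_left:
  assumes N: "N \<lhd> class_group S G" and uv: "(u, v) \<in> nu S D N"
    and s: "s \<in> elts S" "tgt S s = src S u" "s \<cdot> u \<in> D" "s \<cdot> v \<in> D"
  shows "(s \<cdot> u, s \<cdot> v) \<in> nu S D N"
proof -
  note nf = normal_facts[OF N]
  obtain x y a b where xy: "x \<in> N" "y \<in> N"
    and ab: "a \<in> elts S" "b \<in> elts S" "tgt S a = src S e" "src S b = src S e"
    and uv': "u = a \<cdot> x \<cdot> b" "v = a \<cdot> y \<cdot> b"
    using uv nu_iff_elts[OF nf(1)] by blast
  have T: "x \<in> elts S" "y \<in> elts S" "src S x = src S e" "tgt S x = src S e" "src S y = src S e" "tgt S y = src S e"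
    using xy nf(1) G_src[of x] G_src[of y] by auto
  have sa: "tgt S s = src S a" using s(2) ab T unfolding uv' by simp
  have "s \<cdot> u = (s \<cdot> a) \<cdot> x \<cdot> b" "s \<cdot> v = (s \<cdot> a) \<cdot> y \<cdot> b"
    unfolding uv' using sa s(1) ab T by (simp_all add: mul_assoc)
  moreover have "s \<cdot> a \<in> elts S" "tgt S (s \<cdot> a) = src S e" using sa s(1) ab by simp_all
  ultimately show ?thesis using nu_iff_elts[OF nf(1)] s xy ab by blast
qed

lemma nu_right:
  assumes N: "N \<lhd> class_group S G" and uv: "(u, v) \<in> nu S D N"
    and s: "s \<in> elts S" "tgt S u = src S s" "u \<cdot> s \<in> D" "v \<cdot> s \<in> D"
  shows "(u \<cdot> s, v \<cdot> s) \<in> nu S D N"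
proof -
  note nf = normal_facts[OF N]
  obtain x y a b where xy: "x \<in> N" "y \<in> N"
    and ab: "a \<in> elts S" "b \<in> elts S" "tgt S a = src S e" "src S b = src S e"
    and uv': "u = a \<cdot> x \<cdot> b" "v = a \<cdot> y \<cdot> b"
    using uv nu_iff_elts[OF nf(1)] by blast
  have T: "x \<in> elts S" "y \<in> elts S" "src S x = src S e" "tgt S x = src S e" "src S y = src S e" "tgt S y = src S e"
    using xy nf(1) G_src[of x] G_src[of y] by auto
  have sb: "tgt S b = src S s" using s(2) ab T unfolding uv' by simp
  have "u \<cdot> s = a \<cdot> x \<cdot> (b \<cdot> s)" "v \<cdot> s = a \<cdot> y \<cdot> (b \<cdot> s)"
    unfolding uv' using sb s(1) ab T by (simp_all add: mul_assoc)
  moreover have "b \<cdot> s \<in> elts S" "src S (b \<cdot> s) = src S e" using sb s(1) ab by simp_all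
  ultimately show ?thesis using nu_iff_elts[OF nf(1)] s xy ab by blast
qed

end

section \<open>Congruences on ideals\<close>

lemma psg_congD:
  assumes "psg_cong S \<sigma>"
  shows "(x, y) \<in> \<sigma> \<Longrightarrow> x \<in> elts S \<and> y \<in> elts S" "x \<in> elts S \<Longrightarrow> (x, x) \<in> \<sigma>"
    "(x, y) \<in> \<sigma> \<Longrightarrow> (y, x) \<in> \<sigma>" "(x, y) \<in> \<sigma> \<Longrightarrow> (y, z) \<in> \<sigma> \<Longrightarrow> (x, z) \<in> \<sigma>"
    "(x, y) \<in> \<sigma> \<Longrightarrow> parallel S x y"
    "(x, y) \<in> \<sigma> \<Longrightarrow> a \<in> elts S \<Longrightarrow> tgt S a = src S x \<Longrightarrow> (a \<cdot>\<^bsub>S\<^esub> x, a \<cdot>\<^bsub>S\<^esub> y) \<in> \<sigma>"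
    "(x, y) \<in> \<sigma> \<Longrightarrow> a \<in> elts S \<Longrightarrow> tgt S x = src S a \<Longrightarrow> (x \<cdot>\<^bsub>S\<^esub> a, y \<cdot>\<^bsub>S\<^esub> a) \<in> \<sigma>"
proof -
  have eq: "equiv (elts S) \<sigma>" using assms by (simp add: psg_cong_def)
  show "(x, y) \<in> \<sigma> \<Longrightarrow> x \<in> elts S \<and> y \<in> elts S" using equiv_type[OF eq] by blast
  show "x \<in> elts S \<Longrightarrow> (x, x) \<in> \<sigma>" using eq by (simp add: equiv_def refl_on_def)
  show "(x, y) \<in> \<sigma> \<Longrightarrow> (y, x) \<in> \<sigma>" using eq by (auto simp: equiv_def dest: symD)
  show "(x, y) \<in> \<sigma> \<Longrightarrow> (y, z) \<in> \<sigma> \<Longrightarrow> (x, z) \<in> \<sigma>" using eq by (auto simp: equiv_def dest: transD)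
qed (use assms in \<open>auto simp: psg_cong_def\<close>)

lemma psg_congI:
  assumes "\<And>x y. (x, y) \<in> \<sigma> \<Longrightarrow> x \<in> elts S \<and> y \<in> elts S \<and> parallel S x y"
    "\<And>x. x \<in> elts S \<Longrightarrow> (x, x) \<in> \<sigma>"
    "\<And>x y. (x, y) \<in> \<sigma> \<Longrightarrow> (y, x) \<in> \<sigma>" "\<And>x y z. (x, y) \<in> \<sigma> \<Longrightarrow> (y, z) \<in> \<sigma> \<Longrightarrow> (x, z) \<in> \<sigma>"
    "\<And>x y a. (x, y) \<in> \<sigma> \<Longrightarrow> a \<in> elts S \<Longrightarrow> tgt S a = src S x \<Longrightarrow> (a \<cdot>\<^bsub>S\<^esub> x, a \<cdot>\<^bsub>S\<^esub> y) \<in> \<sigma>"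
    "\<And>x y a. (x, y) \<in> \<sigma> \<Longrightarrow> a \<in> elts S \<Longrightarrow> tgt S x = src S a \<Longrightarrow> (x \<cdot>\<^bsub>S\<^esub> a, y \<cdot>\<^bsub>S\<^esub> a) \<in> \<sigma>"
  shows "psg_cong S \<sigma>"
proof -
  have "equiv (elts S) \<sigma>"
  proof (rule equivI)
    show "\<sigma> \<subseteq> elts S \<times> elts S" using assms(1) by auto
    show "refl_on (elts S) \<sigma>" using assms(2) by (simp add: refl_on_def)
    show "sym \<sigma>" using assms(3) by (auto intro: symI)
    show "trans \<sigma>" using assms(4) by (blast intro: transI)
  qed
  then show ?thesis using assms(1,5,6) by (auto simp: psg_cong_def)
qed

lemma cong_gen_least: "psg_cong S \<sigma> \<Longrightarrow> \<Omega> \<subseteq> \<sigma> \<Longrightarrow> cong_gen S \<Omega> \<subseteq> \<sigma>"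
  by (auto simp: cong_gen_def)

text \<open>The empty intersection is the universal relation. Before \<open>cong_gen\<close> may be
  treated as a congruence, some congruence above the generators must therefore be exhibited.\<close>

lemma psg_cong_Inter:
  assumes ne: "C \<noteq> {}" and C: "\<And>\<sigma>. \<sigma> \<in> C \<Longrightarrow> psg_cong S \<sigma>"
  shows "psg_cong S (\<Inter>C)"
proof -
  obtain \<sigma> where s: "\<sigma> \<in> C" using ne by blast
  note f = psg_congD[OF C]
  show ?thesis
  proof (rule psg_congI)
    fix x y assume "(x, y) \<in> \<Inter>C"
    then show "x \<in> elts S \<and> y \<in> elts S \<and> parallel S x y"
      using f(1,5)[OF s, of x y] s by blast
  qed (auto dest: f intro: f(4))
qed

context regular_psg
begin

lemma psg_cong_nabla:
  assumes "psg_ideal S I"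
  shows "psg_cong (sub S I) (nabla S I)"
  by (rule psg_congI) (use ideal_mul[OF assms] ideal_subset[OF assms] in
      \<open>auto simp: nabla_def parallel_def\<close>)

lemma psg_cong_restrict:
  assumes "psg_cong (sub S I) \<sigma>" "psg_ideal S K" "K \<subseteq> I"
  shows "psg_cong (sub S K) (\<sigma> \<inter> K \<times> K)"
proof -
  note f = psg_congD[OF assms(1), simplified]
  have mul: "x \<cdot> y \<in> K" if "x \<in> K" "y \<in> K" "tgt S x = src S y" for x y
    using ideal_mul[OF assms(2)] ideal_subset[OF assms(2)] that by blast
  show ?thesis
  proof (rule psg_congI)
    fix x y assume xy: "(x, y) \<in> \<sigma> \<inter> K \<times> K"
    then have t: "src S x = src S y" "tgt S x = tgt S y" using f(5) by (auto simp: parallel_def)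
    show "x \<in> elts (sub S K) \<and> y \<in> elts (sub S K) \<and> parallel (sub S K) x y"
      "(y, x) \<in> \<sigma> \<inter> K \<times> K"
      using xy f(3,5) by auto
    fix a assume "a \<in> elts (sub S K)"
    then have a: "a \<in> K" "a \<in> I" using assms(3) by auto
    show "(mul (sub S K) a x, mul (sub S K) a y) \<in> \<sigma> \<inter> K \<times> K" if "tgt (sub S K) a = src (sub S K) x"
      using xy a that t f(6)[of x y a] mul[of a x] mul[of a y] by simp
    show "(mul (sub S K) x a, mul (sub S K) y a) \<in> \<sigma> \<inter> K \<times> K" if "tgt (sub S K) x = src (sub S K) a"
      using xy a that t f(7)[of x y a] mul[of x a] mul[of y a] by simp
  next
    fix x y z assume "(x, y) \<in> \<sigma> \<inter> K \<times> K" "(y, z) \<in> \<sigma> \<inter> K \<times> K"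
    then show "(x, z) \<in> \<sigma> \<inter> K \<times> K" using f(4) by blast
  next
    fix x assume "x \<in> elts (sub S K)"
    then show "(x, x) \<in> \<sigma> \<inter> K \<times> K" using f(2) assms(3) by auto
  qed
qed

text \<open>The separation hypotheses yield pairs in a congruence generated inside a small ideal
  \<open>K\<close>. The restriction of \<sigma> to \<open>K\<close> is a congruence there, so these
  pairs belong to \<sigma>.\<close>

lemma cong_gen_sub_subset:
  assumes "psg_cong (sub S I) \<sigma>" "psg_ideal S K" "K \<subseteq> I" "(x, y) \<in> \<sigma>" "x \<in> K" "y \<in> K"
  shows "cong_gen (sub S K) {(x, y)} \<subseteq> \<sigma>"
  using cong_gen_least[OF psg_cong_restrict[OF assms(1-3)], of "{(x, y)}"] assms(4-6) by blast

text \<open>If \<open>f x = x\<close> with \<open>f \<R> x\<close>, then \<open>a x = (a f) x\<close> and \<open>a f\<close> lies in the ideal.\<close>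

lemma psg_cong_extend:
  assumes I: "psg_ideal S I" and \<sigma>: "psg_cong (sub S I) \<sigma>" and H: "\<sigma> \<subseteq> green_H S"
  shows "psg_cong S (\<sigma> \<union> Id_on (elts S))"
proof (rule psg_congI)
  note f = psg_congD[OF \<sigma>, simplified]
  fix x y assume xy: "(x, y) \<in> \<sigma> \<union> Id_on (elts S)"
  show "x \<in> elts S \<and> y \<in> elts S \<and> parallel S x y"
    using xy f(1)[of x y] f(5)[of x y] ideal_subset[OF I] by (auto simp: parallel_def)
  show "(y, x) \<in> \<sigma> \<union> Id_on (elts S)" using xy f(3) by auto
  fix a assume a: "a \<in> elts S"
  show "(a \<cdot> x, a \<cdot> y) \<in> \<sigma> \<union> Id_on (elts S)" if t: "tgt S a = src S x"
  proof (cases "(x, y) \<in> \<sigma>")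
    case True
    then have G: "x \<in> elts S" "y \<in> elts S" "le_R S x x" "le_R S y x" "x \<in> I" "src S y = src S x"
      using f(1)[OF True] H green_H_parallel[of x y] le_R_refl
      by (auto simp: green_H_iff parallel_def)
    \<comment> \<open>Containment in H enters here: y is R-related to x, so the local identity of x
      fixes y as well.\<close>
    obtain g where g: "g \<in> elts S" "tgt S g = src S x" "src S g = src S x" "le_R S g x"
      "\<And>z. le_R S z x \<Longrightarrow> g \<cdot> z = z" using obtain_left_identity[OF G(1)] by metis
    have gI: "a \<cdot> g \<in> I" using ideal_mul[OF I ideal_le_R[OF I G(5) g(4)] a] t g by simp
    have "a \<cdot> x = (a \<cdot> g) \<cdot> x" "a \<cdot> y = (a \<cdot> g) \<cdot> y"
      using a G t g(1-3) g(5)[OF G(3)] g(5)[OF G(4)] by (simp_all add: mul_assoc)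
    then show ?thesis using f(6)[OF True gI] g a t by simp
  next
    case False
    then show ?thesis using xy a t by auto
  qed
  show "(x \<cdot> a, y \<cdot> a) \<in> \<sigma> \<union> Id_on (elts S)" if t: "tgt S x = src S a"
  proof (cases "(x, y) \<in> \<sigma>")
    case True
    then have G: "x \<in> elts S" "y \<in> elts S" "le_L S x x" "le_L S y x" "x \<in> I" "tgt S y = tgt S x"
      using f(1)[OF True] H green_H_parallel[of x y] le_L_refl
      by (auto simp: green_H_iff parallel_def)
    obtain g where g: "g \<in> elts S" "src S g = tgt S x" "tgt S g = tgt S x" "le_L S g x"
      "\<And>z. le_L S z x \<Longrightarrow> z \<cdot> g = z" using obtain_right_identity[OF G(1)] by metis
    have gI: "g \<cdot> a \<in> I" using ideal_mul[OF I ideal_le_L[OF I G(5) g(4)] a] t g by simp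
    have "x \<cdot> a = x \<cdot> (g \<cdot> a)" "y \<cdot> a = y \<cdot> (g \<cdot> a)"
      using a G t g(1-3) g(5)[OF G(3)] g(5)[OF G(4)] by (simp_all add: mul_assoc[symmetric])
    then show ?thesis using f(7)[OF True gI] g a t by simp
  next
    case False
    then show ?thesis using xy a t by auto
  qed
next
  note f = psg_congD[OF \<sigma>, simplified]
  show "\<And>x y z. (x, y) \<in> \<sigma> \<union> Id_on (elts S) \<Longrightarrow> (y, z) \<in> \<sigma> \<union> Id_on (elts S) \<Longrightarrow>
     (x, z) \<in> \<sigma> \<union> Id_on (elts S)"
    using f(4) by blast
qed auto

text \<open>The separation property speaks of zeta of a truncation, while \<open>Z_grp\<close>
  refers to zeta of the whole. Extending by equality turns the former into a congruence on
  \<open>S\<close> inside H, hence below the largest one.\<close>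

lemma zeta_sub_subset:
  assumes I: "psg_ideal S I"
  shows "zeta (sub S I) \<subseteq> zeta S"
proof -
  interpret T: regular_psg "sub S I" using regular_psg_sub[OF I] .
  have "zeta (sub S I) \<subseteq> green_H S"
    using T.zeta_greatest(2) green_H_sub[OF I] by auto
  then have "psg_cong S (zeta (sub S I) \<union> Id_on (elts S))"
    "zeta (sub S I) \<union> Id_on (elts S) \<subseteq> green_H S"
    using psg_cong_extend[OF I T.zeta_greatest(1)] green_H_refl by auto
  then show ?thesis using zeta_greatest(3) by blast
qed

end

section \<open>Chains of ideals\<close>

locale ideal_chain = stable_psg +
  fixes \<xi> :: enat and D :: "nat \<Rightarrow> 'a set"
  assumes D_classes: "D ` {q. enat q < \<xi>} = J_classes S"
    and D_order: "enat p < \<xi> \<Longrightarrow> enat q < \<xi> \<Longrightarrow> J_le S (D p) (D q) \<longleftrightarrow> p \<le> q"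
begin

abbreviation I :: "enat \<Rightarrow> 'a set" where "I \<equiv> I_layer D"

lemma D_eq:
  assumes "enat p < \<xi>" "x \<in> D p"
  shows "x \<in> elts S" "D p = green_J S `` {x}"
proof -
  have "D p \<in> J_classes S" using assms D_classes by blast
  then obtain y where y: "y \<in> elts S" "D p = green_J S `` {y}" by (auto elim: quotientE)
  then have yx: "(y, x) \<in> green_J S" using assms by simp
  then show "x \<in> elts S" "D p = green_J S `` {x}"
    using y equiv_class_eq[OF equiv_green_J yx] by (auto simp: green_J_le_iff)
qed

lemma D_nonempty:
  assumes "enat p < \<xi>" obtains x where "x \<in> D p"
proof -
  have "D p \<in> J_classes S" using assms D_classes by blast
  then show ?thesis using that equiv_class_self[OF equiv_green_J] by (auto elim!: quotientE)
qed

lemma obtain_level: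
  assumes "x \<in> elts S" obtains p where "enat p < \<xi>" "x \<in> D p"
proof -
  have "green_J S `` {x} \<in> D ` {q. enat q < \<xi>}"
    unfolding D_classes using assms by (rule quotientI)
  then show ?thesis using that equiv_class_self[OF equiv_green_J assms] by auto
qed

lemma le_J_level:
  assumes "enat p < \<xi>" "enat q < \<xi>" "x \<in> D p" "y \<in> D q"
  shows "le_J S x y \<longleftrightarrow> p \<le> q"
proof -
  have "J_le S (D p) (D q) \<longleftrightarrow> le_J S x y"
  proof
    assume "J_le S (D p) (D q)"
    then obtain x' y' where xy: "x' \<in> D p" "y' \<in> D q" "Inl x' \<in> principal S y'"
      unfolding J_le_def by blast
    have el: "x' \<in> elts S" "y' \<in> elts S" "y \<in> elts S" "x \<in> elts S"
      using xy D_eq assms by blast+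
    then have 1: "le_J S x' y'" using xy in_principal_iff by blast
    have "(x, x') \<in> green_J S" "(y', y) \<in> green_J S"
      using xy D_eq(2) assms by blast+
    then show "le_J S x y" using 1 el le_J_trans unfolding green_J_le_iff by metis
  next
    assume "le_J S x y"
    then show "J_le S (D p) (D q)"
      unfolding J_le_def using in_principal_iff[of y x] D_eq(1)[of q y] assms by blast
  qed
  then show ?thesis using D_order assms by blast
qed

lemma level_unique: "enat p < \<xi> \<Longrightarrow> enat q < \<xi> \<Longrightarrow> x \<in> D p \<Longrightarrow> x \<in> D q \<Longrightarrow> p = q"
  using le_J_level[of p q x x] le_J_level[of q p x x] D_eq(1) le_J_refl by force

lemma D_upI:
  assumes "enat p < \<xi>" "x \<in> D p" "y \<in> elts S" "le_J S x y" "le_J S y x"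
  shows "y \<in> D p"
  using D_eq[OF assms(1,2)] assms by (auto simp: green_J_le_iff)

lemma H_same_level: "enat p < \<xi> \<Longrightarrow> x \<in> D p \<Longrightarrow> (x, y) \<in> green_H S \<Longrightarrow> y \<in> D p"
  using D_eq(2) green_H_imp_J by blast

definition valid :: "enat \<Rightarrow> bool" where
  "valid r \<longleftrightarrow> r < \<xi> \<or> r = \<infinity> \<and> \<xi> = \<infinity>"

lemma valid_level: "valid r \<Longrightarrow> enat p \<le> r \<Longrightarrow> enat p < \<xi>"
  unfolding valid_def by (auto intro: le_less_trans)

lemma valid_enat: "valid (enat p) \<longleftrightarrow> enat p < \<xi>"
  by (auto simp: valid_def)

lemma I_iff: "x \<in> I r \<longleftrightarrow> (\<exists>p. enat p \<le> r \<and> x \<in> D p)"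
  by (auto simp: I_layer_def)

lemma I_enat_iff: "x \<in> I (enat n) \<longleftrightarrow> (\<exists>p\<le>n. x \<in> D p)"
  by (auto simp: I_iff)

lemma I_mono: "r \<le> s \<Longrightarrow> I r \<subseteq> I s"
  unfolding I_layer_def by (auto intro: order_trans)

lemma I_elts: "valid r \<Longrightarrow> x \<in> I r \<Longrightarrow> x \<in> elts S"
  using D_eq(1) valid_level I_iff by blast

lemma I_level_iff:
  assumes "valid r" "enat p < \<xi>" "x \<in> D p"
  shows "x \<in> I r \<longleftrightarrow> enat p \<le> r"
  using assms valid_level level_unique I_iff by metis

lemma le_J_I:
  assumes "valid r" "x \<in> I r" "y \<in> elts S" "le_J S y x"
  shows "y \<in> I r"
proof -
  obtain p where p: "enat p \<le> r" "x \<in> D p" using assms I_iff by blast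
  obtain q where q: "enat q < \<xi>" "y \<in> D q" using obtain_level assms by blast
  have "q \<le> p" using le_J_level[OF q(1) valid_level[OF assms(1) p(1)] q(2) p(2)] assms by blast
  then show ?thesis using p q I_iff by (metis enat_ord_simps(1) order_trans)
qed

lemma I_ideal:
  assumes r: "valid r"
  shows "psg_ideal S (I r)"
proof -
  have "enat 0 < \<xi>" using valid_level[OF r, of 0] by (simp add: zero_enat_def[symmetric])
  then have "I r \<noteq> {}"
    using D_nonempty[of 0] I_iff[of _ r] by (metis all_not_in_conv zero_enat_def zero_le)
  moreover have "s \<cdot> x \<in> I r" if "x \<in> I r" "s \<in> elts S" "tgt S s = src S x" for s x
    using le_J_I[OF r that(1)] le_L_imp_J[OF le_L_mul[of x s]] that I_elts[OF r] by simp
  moreover have "x \<cdot> s \<in> I r" if "x \<in> I r" "s \<in> elts S" "tgt S x = src S s" for s x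
    using le_J_I[OF r that(1)] le_R_imp_J[OF le_R_mul[of x s]] that I_elts[OF r] by simp
  ultimately show ?thesis
    unfolding psg_ideal_def using I_elts[OF r] by blast
qed

lemma I_Suc: "I (enat (Suc n)) = I (enat n) \<union> D (Suc n)"
  by (auto simp: I_enat_iff le_Suc_eq)

lemma I_Suc_diff:
  assumes "enat (Suc n) < \<xi>" shows "I (enat (Suc n)) - D (Suc n) = I (enat n)"
proof -
  have "x \<notin> I (enat n)" if "x \<in> D (Suc n)" for x
  proof -
    have "enat n < \<xi>" using assms by (meson enat_ord_simps(1) le_SucI order_refl order_le_less_trans)
    then show ?thesis
      using I_level_iff[of "enat n" "Suc n" x] that assms by (simp add: valid_enat)
  qed
  then show ?thesis unfolding I_Suc by blast
qed

lemma D_in_J_classes_sub: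
  assumes "enat p \<le> r" "valid r"
  shows "D p \<in> J_classes (sub S (I r))"
proof -
  have p: "enat p < \<xi>" using valid_level assms by blast
  obtain x where x: "x \<in> D p" using D_nonempty[OF p] .
  have DI: "D p \<subseteq> I r" using I_iff assms(1) by blast
  have "y \<in> D p \<longleftrightarrow> (x, y) \<in> green_J (sub S (I r))" for y
    using D_eq(2)[OF p x] DI x green_J_sub[OF I_ideal[OF assms(2)]] by blast
  then have "D p = green_J (sub S (I r)) `` {x}" by blast
  then show ?thesis using x DI by (metis quotientI subsetD sub_simps(1))
qed

lemma level_le: "m \<le> n \<Longrightarrow> enat n < \<xi> \<Longrightarrow> enat m < \<xi>"
  by (meson enat_ord_simps(1) order_le_less_trans)

text \<open>Since \<open>top_J\<close> is a definite description, uniqueness is needed too: a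
  maximum class lies above \<open>D p\<close>, so it contains an element of level at least p, and p
  is the highest level in the truncation.\<close>

lemma top_J_sub:
  assumes p: "enat p < \<xi>"
  shows "top_J (sub S (I (enat p))) = D p"
proof -
  have v: "valid (enat p)" using p by (simp add: valid_enat)
  note I = I_ideal[OF v]
  interpret T: regular_psg "sub S (I (enat p))" using regular_psg_sub[OF I] .
  let ?T = "sub S (I (enat p))"
  have J: "J_le ?T K M \<longleftrightarrow> (\<exists>x\<in>K. \<exists>y\<in>M. le_J S x y)"
    if "K \<subseteq> I (enat p)" "M \<subseteq> I (enat p)" for K M
  proof -
    have "Inl x \<in> principal ?T y \<longleftrightarrow> le_J S x y" if "y \<in> M" for x y
      using T.in_principal_iff[of y x] le_J_sub[OF I, of y x] that \<open>M \<subseteq> I (enat p)\<close> by auto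
    then show ?thesis unfolding J_le_def by blast
  qed
  have cl: "K \<subseteq> I (enat p)" "K \<noteq> {}" if "K \<in> J_classes ?T" for K
    using in_quotient_imp_subset[OF T.equiv_green_J that]
      in_quotient_imp_non_empty[OF T.equiv_green_J that] by simp_all
  have DI: "D p \<subseteq> I (enat p)" using I_enat_iff by blast
  obtain d where d: "d \<in> D p" using D_nonempty[OF p] .
  have DJ: "D p \<in> J_classes ?T" using D_in_J_classes_sub[OF order_refl v] .
  have "max_J_class ?T (D p)"
    unfolding max_J_class_def
  proof (intro conjI ballI)
    show "D p \<in> J_classes ?T" by (rule DJ)
    fix K assume K: "K \<in> J_classes ?T"
    obtain x where x: "x \<in> K" using cl(2)[OF K] by blast
    obtain k where k: "k \<le> p" "x \<in> D k" using x cl(1)[OF K] I_enat_iff by blast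
    have "le_J S x d" using le_J_level[OF level_le[OF k(1) p] p k(2) d] k(1) by simp
    then show "J_le ?T K (D p)" unfolding J[OF cl(1)[OF K] DI] using x d by blast
  qed
  moreover have "M = D p" if M: "max_J_class ?T M" for M
  proof -
    have MJ: "M \<in> J_classes ?T" using M unfolding max_J_class_def by blast
    have "J_le ?T (D p) M" using M DJ unfolding max_J_class_def by blast
    then obtain x m where x: "x \<in> D p" "m \<in> M" "le_J S x m"
      using J[OF DI cl(1)[OF MJ]] by blast
    obtain k where k: "k \<le> p" "m \<in> D k" using x cl(1)[OF MJ] I_enat_iff by blast
    have kx: "enat k < \<xi>" using level_le[OF k(1) p] .
    have "p \<le> k" using le_J_level[OF p kx x(1) k(2)] x by blast
    then have mp: "m \<in> D p" using k le_antisym by blast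
    have "M \<inter> D p \<noteq> {}" using x(2) mp by blast
    then show "M = D p"
      using quotient_disj[OF T.equiv_green_J MJ DJ] by blast
  qed
  ultimately show ?thesis unfolding top_J_def by (rule the_equality)
qed

end

section \<open>Congruences at a single level and normal subgroups\<close>

context group_class
begin

text \<open>Multiplying by c and d, which lie in the ideal, turns (u, v) into (\<open>e\<close>, c v
  d), and the coordinate c v d decides membership in \<open>nu\<close>. Only an inclusion is asked
  of \<open>N\<close>, so the lemma serves both the subgroups read off from a congruence and the
  condition on \<open>down\<close>.\<close>

lemma cong_imp_nu:
  assumes I: "psg_ideal S I" "e \<in> I" and \<sigma>: "psg_cong (sub S I) \<sigma>"
    and N: "N \<lhd> class_group S G" "{g \<in> G. (e, g) \<in> \<sigma>} \<subseteq> N"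
    and uv: "(u, v) \<in> \<sigma>" "(u, v) \<in> green_H S" "u \<in> D"
  shows "(u, v) \<in> nu S D N"
proof -
  note f = psg_congD[OF \<sigma>, simplified]
  obtain a b c d where F: "factors S e u a b c d" using obtain_factors[OF uv(3)] by metis
  have ty: "c \<in> elts S" "d \<in> elts S" "tgt S c = src S u" "src S d = tgt S u"
    using F by (simp_all add: factors_def)
  have "le_J S c e" "le_J S d e" using factors_mem_D[OF F] D_iff by blast+
  then have cd: "c \<in> I" "d \<in> I" using ideal_le_J[OF I] by blast+
  have par: "src S v = src S u" "tgt S v = tgt S u" "u \<in> elts S" "v \<in> elts S"
    using green_H_parallel[OF uv(2)] uv(2) by (auto simp: parallel_def green_H_iff)
  have "(c \<cdot> u, c \<cdot> v) \<in> \<sigma>" using f(6)[OF uv(1) cd(1)] ty by simp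
  then have "(c \<cdot> u \<cdot> d, c \<cdot> v \<cdot> d) \<in> \<sigma>"
    using f(7)[of "c \<cdot> u" "c \<cdot> v" d] cd(2) ty par by simp
  then have "(e, c \<cdot> v \<cdot> d) \<in> \<sigma>" using factors_base[OF F] by simp
  then have "c \<cdot> v \<cdot> d \<in> N" using N(2) factors_H(1)[OF F uv(2)] by blast
  then show ?thesis using nu_iff[OF N(1) F uv(3)] uv(2) by blast
qed

text \<open>The reverse translation: (\<open>e\<close>, x) with x the coordinate of v becomes (a e
  b, a x b) = (u, v). The multipliers are admissible because a = a e and b = e b lie in the
  ideal.\<close>

lemma nu_imp_cong:
  assumes I: "psg_ideal S I" "e \<in> I" and \<sigma>: "psg_cong (sub S I) \<sigma>"
    and N: "N \<lhd> class_group S G" "\<And>g. g \<in> N \<Longrightarrow> (e, g) \<in> \<sigma>"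
    and uv: "(u, v) \<in> nu S D N"
  shows "(u, v) \<in> \<sigma>"
proof -
  note f = psg_congD[OF \<sigma>, simplified]
  have H: "(u, v) \<in> green_H S" "u \<in> D" using nu_H[OF N(1) uv] by auto
  obtain a b c d where F: "factors S e u a b c d" using obtain_factors[OF H(2)] by metis
  have ty: "a \<in> elts S" "b \<in> elts S" "tgt S a = src S e" "src S b = src S e"
    and eq: "a \<cdot> e = a" "e \<cdot> b = b" "a \<cdot> b = u"
    using F by (simp_all add: factors_def)
  have ab: "a \<in> I" "b \<in> I"
    using ideal_mul(1)[OF I ty(1,3)] ideal_mul(2)[OF I ty(2)] ty(4) eq by simp_all
  define x where "x = c \<cdot> v \<cdot> d"
  have x: "x \<in> N" using nu_iff[OF N(1) F H(2)] uv by (simp add: x_def)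
  then have xG: "x \<in> G" using normal_facts(1)[OF N(1)] by blast
  have v: "a \<cdot> x \<cdot> b = v" using factors_H(2)[OF F H(1)] by (simp add: x_def)
  have "(a \<cdot> e, a \<cdot> x) \<in> \<sigma>" using f(6)[OF N(2)[OF x] ab(1)] ty by simp
  then have "(a \<cdot> e \<cdot> b, a \<cdot> x \<cdot> b) \<in> \<sigma>" using f(7)[of "a \<cdot> e" "a \<cdot> x" b] ab ty by simp
  then show ?thesis using eq v by simp
qed

lemma cong_normal:
  assumes I: "psg_ideal S I" "e \<in> I" and \<sigma>: "psg_cong (sub S I) \<sigma>"
  shows "{g \<in> G. (e, g) \<in> \<sigma>} \<lhd> class_group S G" (is "?N \<lhd> _")
proof -
  interpret grp: group "class_group S G" by (rule is_group)
  note f = psg_congD[OF \<sigma>, simplified]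
  have GI: "x \<in> I" if "x \<in> G" for x
    using that ideal_mul(2)[OF I G_elts[OF that]] G_src(1)[OF that] by simp
  have L: "(z \<cdot> x, z \<cdot> y) \<in> \<sigma>" if "(x, y) \<in> \<sigma>" "x \<in> G" "y \<in> G" "z \<in> G" for x y z
    using f(6)[OF that(1) GI[OF that(4)]] G_src[OF that(2)] G_src[OF that(4)] by simp
  have R: "(x \<cdot> z, y \<cdot> z) \<in> \<sigma>" if "(x, y) \<in> \<sigma>" "x \<in> G" "y \<in> G" "z \<in> G" for x y z
    using f(7)[OF that(1) GI[OF that(4)]] G_src[OF that(2)] G_src[OF that(4)] by simp
  have inv: "inv\<^bsub>class_group S G\<^esub> x \<in> G" "x \<cdot> inv\<^bsub>class_group S G\<^esub> x = e"
    "inv\<^bsub>class_group S G\<^esub> x \<cdot> x = e" if "x \<in> G" for x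
    using grp.inv_closed[of x] grp.r_inv[of x] grp.l_inv[of x] that by simp_all
  have "subgroup ?N (class_group S G)"
  proof (rule grp.subgroupI)
    show "?N \<subseteq> carrier (class_group S G)" by auto
    show "?N \<noteq> {}" using f(2)[OF I(2)] e_G by blast
    fix x assume "x \<in> ?N"
    then have x: "x \<in> G" "(e, x) \<in> \<sigma>" by auto
    have "(inv\<^bsub>class_group S G\<^esub> x \<cdot> e, inv\<^bsub>class_group S G\<^esub> x \<cdot> x) \<in> \<sigma>"
      by (rule L[OF x(2) e_G x(1) inv(1)[OF x(1)]])
    then show "inv\<^bsub>class_group S G\<^esub> x \<in> ?N" using inv[OF x(1)] f(3) by simp
    fix y assume "y \<in> ?N"
    then have y: "y \<in> G" "(e, y) \<in> \<sigma>" by auto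
    have "(x \<cdot> e, x \<cdot> y) \<in> \<sigma>" by (rule L[OF y(2) e_G y(1) x(1)])
    then show "x \<otimes>\<^bsub>class_group S G\<^esub> y \<in> ?N" using x f(4)[OF x(2)] G_mul[OF x(1) y(1)] by simp
  qed
  moreover have "x \<cdot> h \<cdot> inv\<^bsub>class_group S G\<^esub> x \<in> ?N" if "x \<in> G" "h \<in> ?N" for x h
  proof -
    have h: "h \<in> G" "(e, h) \<in> \<sigma>" using that by auto
    have "(x \<cdot> e, x \<cdot> h) \<in> \<sigma>" by (rule L[OF h(2) e_G h(1) that(1)])
    then have "(x \<cdot> inv\<^bsub>class_group S G\<^esub> x, x \<cdot> h \<cdot> inv\<^bsub>class_group S G\<^esub> x) \<in> \<sigma>"
      using R[of x "x \<cdot> h" "inv\<^bsub>class_group S G\<^esub> x"] that(1) G_mul[OF that(1) h(1)]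
        inv(1)[OF that(1)] by simp
    then show ?thesis
      using inv[OF that(1)] G_mul[OF G_mul[OF that(1) h(1)] inv(1)[OF that(1)]] by simp
  qed
  ultimately show ?thesis unfolding grp.normal_inv_iff by simp
qed

text \<open>Any two elements of \<open>N\<close> are zeta-related through \<open>e\<close>, and zeta
  is preserved by the two multipliers.\<close>

lemma nu_subset_zeta:
  assumes N: "N \<subseteq> Z_grp S G"
  shows "nu S D N \<subseteq> zeta S"
proof (rule subrelI)
  note z = psg_congD[OF zeta_greatest(1)]
  have NG: "N \<subseteq> G" using N by (auto simp: Z_grp_def)
  fix u v assume "(u, v) \<in> nu S D N"
  then obtain x y a b where xy: "x \<in> N" "y \<in> N"
    and ab: "a \<in> elts S" "b \<in> elts S" "tgt S a = src S e" "src S b = src S e"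
    and uv: "u = a \<cdot> x \<cdot> b" "v = a \<cdot> y \<cdot> b"
    unfolding nu_iff_elts[OF NG] by blast
  have G: "x \<in> G" "y \<in> G" using xy NG by auto
  have "(x, y) \<in> zeta S" using xy N z(3,4) unfolding Z_grp_def by blast
  then have "(a \<cdot> x, a \<cdot> y) \<in> zeta S" using z(6)[of x y a] ab(1,3) G_src[OF G(1)] by simp
  then show "(u, v) \<in> zeta S"
    unfolding uv using z(7)[of "a \<cdot> x" "a \<cdot> y" b] ab G_src[OF G(1)] G by simp
qed

end

section \<open>Separation hypotheses and the collapse of ideals\<close>

locale separated_chain = ideal_chain +
  fixes G :: "nat \<Rightarrow> 'a set"
  assumes groups: "enat q < \<xi> \<Longrightarrow> group_H_class S (G q) \<and> G q \<subseteq> D q"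
    and trivial: "\<lbrakk>A \<in> objs S; B \<in> objs S\<rbrakk> \<Longrightarrow> \<exists>!x. x \<in> hom_set S A B \<and> x \<in> D 0"
    and sep1: "\<lbrakk>enat 1 < \<xi>; x \<in> D 1; y \<in> D 1 - H_class S x; parallel S x y\<rbrakk>
      \<Longrightarrow> \<exists>(x', y') \<in> cong_gen (sub S (I_layer D (enat 1))) {(x, y)}. x' \<in> D 1 \<and> y' \<in> D 0"
    and sep: "\<lbrakk>2 \<le> p; enat p < \<xi>\<rbrakk> \<Longrightarrow> Sep_zeta (sub S (I_layer D (enat p)))"
begin

text \<open>The clauses (S1), (S2), (S3) in the notation of the whole chain:
  \<open>top_J_sub\<close> identifies the top classes of the truncations with
  \<open>D (Suc m)\<close> and \<open>D m\<close>, and H on an ideal is the restriction of H on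
  \<open>S\<close>.\<close>

lemma Sep_zeta_elts:
  assumes m: "1 \<le> m" "enat (Suc m) < \<xi>"
  shows "\<And>x y. \<lbrakk>x \<in> D (Suc m); y \<in> I (enat m); parallel S x y\<rbrakk> \<Longrightarrow>
      \<exists>(x', y') \<in> cong_gen (sub S (I (enat (Suc m)))) {(x, y)}.
        x' \<in> D m \<and> y' \<in> I (enat m) \<and> (x', y') \<notin> green_H S"
    and "\<And>x y. \<lbrakk>x \<in> D (Suc m); y \<in> D (Suc m); (x, y) \<notin> green_H S; parallel S x y\<rbrakk> \<Longrightarrow>
      \<exists>(x', y') \<in> cong_gen (sub S (I (enat (Suc m)))) {(x, y)}. x' \<in> D (Suc m) \<and> y' \<in> I (enat m)"
    and "\<And>x y. \<lbrakk>x \<in> D (Suc m); y \<in> D (Suc m); (x, y) \<in> green_H S;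
        (x, y) \<notin> zeta (sub S (I (enat (Suc m))))\<rbrakk> \<Longrightarrow>
      \<exists>(x', y') \<in> cong_gen (sub S (I (enat (Suc m)))) {(x, y)}.
        x' \<in> D m \<and> y' \<in> I (enat m) \<and> (x', y') \<notin> green_H S"
proof -
  let ?T = "sub S (I (enat (Suc m)))"
  have m': "enat m < \<xi>" using level_le[of m "Suc m"] m by simp
  have v: "valid (enat m)" "valid (enat (Suc m))" using m m' by (simp_all add: valid_enat)
  have DI: "D m \<subseteq> I (enat m)" "D (Suc m) \<subseteq> I (enat (Suc m))" by (auto simp: I_enat_iff)
  have top: "top_J ?T = D (Suc m)" "top_J (sub S (I (enat m))) = D m"
    using top_J_sub m m' by blast+
  have dif: "I (enat (Suc m)) - D (Suc m) = I (enat m)" using I_Suc_diff m by blast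
  have H: "y' \<in> I (enat m) \<and> (x', y') \<notin> green_H S"
    if "x' \<in> D m" "y' \<in> I (enat m) - H_class (sub S (I (enat m))) x'" for x' y'
    using that green_H_sub[OF I_ideal[OF v(1)]] DI by blast
  have S: "Sep_zeta ?T" using sep[of "Suc m"] m by simp
  note S = S[unfolded Sep_zeta_def Let_def top sub_simps dif]
  let ?C = "\<lambda>x y. cong_gen ?T {(x, y)}"
  let ?sep = "\<lambda>x y. \<exists>(x', y') \<in> ?C x y. x' \<in> D m \<and> y' \<in> I (enat m) - H_class (sub S (I (enat m))) x'"
  have s1: "\<forall>x\<in>D (Suc m). \<forall>y\<in>I (enat m). parallel S x y \<longrightarrow> ?sep x y"
    and s2: "\<forall>x\<in>D (Suc m). \<forall>y\<in>D (Suc m) - H_class ?T x. parallel S x y \<longrightarrow>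
      (\<exists>(x', y') \<in> ?C x y. x' \<in> D (Suc m) \<and> y' \<in> I (enat m))"
    and s3: "\<forall>x\<in>D (Suc m). \<forall>y\<in>D (Suc m). (x, y) \<in> green_H ?T - zeta ?T \<longrightarrow> ?sep x y"
    using S by (iprover)+
  have sepD: "\<exists>(x', y') \<in> ?C x y. x' \<in> D m \<and> y' \<in> I (enat m) \<and> (x', y') \<notin> green_H S"
    if sxy: "?sep x y" for x y
  proof -
    obtain x' y' where 1: "(x', y') \<in> ?C x y" "x' \<in> D m" "y' \<in> I (enat m) - H_class (sub S (I (enat m))) x'"
      using sxy by blast
    show ?thesis using 1 H[OF 1(2,3)] by blast
  qed
  show "\<exists>(x', y') \<in> ?C x y. x' \<in> D m \<and> y' \<in> I (enat m) \<and> (x', y') \<notin> green_H S"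
    if "x \<in> D (Suc m)" "y \<in> I (enat m)" "parallel S x y" for x y
    using sepD[OF s1[rule_format, OF that]] .
  show "\<exists>(x', y') \<in> ?C x y. x' \<in> D (Suc m) \<and> y' \<in> I (enat m)"
    if "x \<in> D (Suc m)" "y \<in> D (Suc m)" "(x, y) \<notin> green_H S" "parallel S x y" for x y
  proof -
    have "y \<in> D (Suc m) - H_class ?T x"
      using that green_H_sub[OF I_ideal[OF v(2)], of x y] by blast
    then show ?thesis using s2[rule_format, OF that(1) _ that(4)] by simp
  qed
  show "\<exists>(x', y') \<in> ?C x y. x' \<in> D m \<and> y' \<in> I (enat m) \<and> (x', y') \<notin> green_H S"
    if "x \<in> D (Suc m)" "y \<in> D (Suc m)" "(x, y) \<in> green_H S" "(x, y) \<notin> zeta ?T" for x y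
  proof -
    have "(x, y) \<in> green_H ?T - zeta ?T"
      using that DI(2) green_H_sub[OF I_ideal[OF v(2)], of x y] by blast
    then show ?thesis using sepD[OF s3[rule_format, OF that(1,2)]] by simp
  qed
qed

text \<open>Such a pair collapses the ideal \<open>I\<^sub>n\<^sub>+\<^sub>1\<close>.\<close>

definition links :: "'a rel \<Rightarrow> nat \<Rightarrow> bool" where
  "links \<sigma> n \<longleftrightarrow> (\<exists>x y. (x, y) \<in> \<sigma> \<and> x \<in> D (Suc n) \<and> y \<in> I (enat n))"

context
  fixes r \<sigma>
  assumes r: "valid r" and \<sigma>: "psg_cong (sub S (I r)) \<sigma>"
begin

lemmas \<sigma>_facts = psg_congD[OF \<sigma>, simplified]

lemma cong_gen_in:
  assumes "enat n \<le> r" "(x, y) \<in> \<sigma>" "x \<in> I (enat n)" "y \<in> I (enat n)"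
  shows "cong_gen (sub S (I (enat n))) {(x, y)} \<subseteq> \<sigma>"
proof -
  have "valid (enat n)" using valid_level[OF r assms(1)] by (simp add: valid_enat)
  then show ?thesis
    using cong_gen_sub_subset[OF \<sigma> I_ideal I_mono[OF assms(1)] assms(2-4)] by blast
qed

text \<open>If y is already below level n + 1, the pair is a link itself. Otherwise both entries lie
  on level n + 1 without being H-related, and a link comes from the hypothesis on \<open>D 1\<close>
  when n = 0 and from (S2) when n > 0.\<close>

lemma links_if_not_H:
  assumes n: "enat (Suc n) \<le> r" and xy: "(x, y) \<in> \<sigma>" "x \<in> D (Suc n)" "y \<in> I (enat (Suc n))"
    "(x, y) \<notin> green_H S"
  shows "links \<sigma> n"
proof (cases "y \<in> I (enat n)")
  case True
  then show ?thesis using xy unfolding links_def by blast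
next
  case False
  then have y: "y \<in> D (Suc n)" using xy I_Suc by blast
  have xI: "x \<in> I (enat (Suc n))" using xy I_Suc by blast
  have n\<xi>: "enat (Suc n) < \<xi>" using valid_level[OF r n] .
  have par: "parallel S x y" using \<sigma>_facts(5)[OF xy(1)] .
  have sub: "cong_gen (sub S (I (enat (Suc n)))) {(x, y)} \<subseteq> \<sigma>"
    using cong_gen_in[OF n xy(1) xI xy(3)] .
  have "\<exists>(x', y') \<in> cong_gen (sub S (I (enat (Suc n)))) {(x, y)}. x' \<in> D (Suc n) \<and> y' \<in> I (enat n)"
  proof (cases n)
    case 0
    have "D 0 = I (enat 0)" by (auto simp: I_enat_iff)
    then show ?thesis using sep1[of x y] n\<xi> xy y par 0 by simp
  next
    case (Suc k)
    then show ?thesis using Sep_zeta_elts(2)[of n x y] n\<xi> xy y par by simp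
  qed
  then show ?thesis using sub unfolding links_def by blast
qed

text \<open>(S1) turns the link into a pair that is not H-related and whose first entry is on level
  n + 1; \<open>links_if_not_H\<close> makes a lower link of it.\<close>

lemma links_pred:
  assumes n: "enat (Suc (Suc n)) \<le> r" and "links \<sigma> (Suc n)"
  shows "links \<sigma> n"
proof -
  obtain x y where xy: "(x, y) \<in> \<sigma>" "x \<in> D (Suc (Suc n))" "y \<in> I (enat (Suc n))"
    using assms unfolding links_def by blast
  have I: "x \<in> I (enat (Suc (Suc n)))" "y \<in> I (enat (Suc (Suc n)))"
    using xy I_Suc by blast+
  have n': "enat (Suc n) \<le> r" using n by (meson enat_ord_simps(1) le_SucI order_refl order_trans)
  obtain x' y' where "(x', y') \<in> \<sigma>" "x' \<in> D (Suc n)" "y' \<in> I (enat (Suc n))" "(x', y') \<notin> green_H S"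
    using Sep_zeta_elts(1)[of "Suc n" x y] valid_level[OF r n] xy \<sigma>_facts(5)[OF xy(1)]
      cong_gen_in[OF n xy(1) I] by auto
  then show ?thesis using links_if_not_H[OF n'] by blast
qed

text \<open>(S3) is stated with zeta of the truncation. By \<open>zeta_sub_subset\<close> that
  relation is contained in zeta of \<open>S\<close>, so a pair outside the latter qualifies. The
  pair it produces starts on level n + 1, which accounts for the drop of the link to n.\<close>

lemma links_if_not_zeta:
  assumes n: "enat (Suc (Suc n)) \<le> r"
    and xy: "(x, y) \<in> \<sigma>" "x \<in> D (Suc (Suc n))" "y \<in> D (Suc (Suc n))" "(x, y) \<in> green_H S"
    and z: "(x, y) \<notin> zeta S"
  shows "links \<sigma> n"
proof -
  have I: "x \<in> I (enat (Suc (Suc n)))" "y \<in> I (enat (Suc (Suc n)))"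
    using xy I_Suc by blast+
  have n': "enat (Suc n) \<le> r" using n by (meson enat_ord_simps(1) le_SucI order_refl order_trans)
  have "valid (enat (Suc (Suc n)))" using valid_level[OF r n] by (simp add: valid_enat)
  then have "(x, y) \<notin> zeta (sub S (I (enat (Suc (Suc n)))))"
    using z zeta_sub_subset[OF I_ideal] by blast
  then obtain x' y' where "(x', y') \<in> \<sigma>" "x' \<in> D (Suc n)" "y' \<in> I (enat (Suc n))" "(x', y') \<notin> green_H S"
    using Sep_zeta_elts(3)[of "Suc n" x y] valid_level[OF r n] xy
      cong_gen_in[OF n xy(1) I] by auto
  then show ?thesis using links_if_not_H[OF n'] by blast
qed

lemma nabla_I0: "nabla S (I (enat 0)) \<subseteq> \<sigma>"
proof (rule subrelI)
  fix x y assume "(x, y) \<in> nabla S (I (enat 0))"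
  then have xy: "x \<in> D 0" "y \<in> D 0" "parallel S x y" by (auto simp: nabla_def I_enat_iff)
  have xI: "x \<in> I r" using xy I_iff[of x r] zero_enat_def by (metis zero_le)
  have "enat 0 < \<xi>" using valid_level[OF r, of 0] by (simp add: zero_enat_def[symmetric])
  then have el: "x \<in> elts S" "y \<in> elts S" using D_eq(1) xy by blast+
  have "x = y"
    using trivial[of "src S x" "tgt S x"] xy el unfolding hom_set_def parallel_def by auto
  then show "(x, y) \<in> \<sigma>" using \<sigma>_facts(2) xI by blast
qed

text \<open>Every z on level n + 1 is a x b with x the upper entry of the link, hence related to a y
  b in I_n. Parallel elements are thereby moved to parallel elements of I_n, which are already
  identified.\<close>

lemma nabla_step:
  assumes n: "enat (Suc n) \<le> r" and nab: "nabla S (I (enat n)) \<subseteq> \<sigma>" and l: "links \<sigma> n"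
  shows "nabla S (I (enat (Suc n))) \<subseteq> \<sigma>"
proof -
  obtain x y where xy: "(x, y) \<in> \<sigma>" "x \<in> D (Suc n)" "y \<in> I (enat n)"
    using l unfolding links_def by blast
  have n\<xi>: "enat (Suc n) < \<xi>" using valid_level[OF r n] .
  have vn: "valid (enat n)" using level_le[of n "Suc n"] n\<xi> by (simp add: valid_enat)
  have xI: "x \<in> I r" "x \<in> elts S" "y \<in> elts S"
    using \<sigma>_facts(1)[OF xy(1)] I_elts[OF r] by auto
  have par: "src S y = src S x" "tgt S y = tgt S x"
    using \<sigma>_facts(5)[OF xy(1)] by (auto simp: parallel_def)
  have ex: "\<exists>w\<in>I (enat n). (z, w) \<in> \<sigma>" if z: "z \<in> I (enat (Suc n))" for z
  proof (cases "z \<in> I (enat n)")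
    case True
    have "z \<in> I r" using z I_mono[OF n] by blast
    then show ?thesis using True \<sigma>_facts(2) by blast
  next
    case False
    then have zD: "z \<in> D (Suc n)" using z I_Suc by blast
    \<comment> \<open>The preorder of the ideal is used because \<sigma> is compatible only with
      multipliers from I_r.\<close>
    have "le_J (sub S (I r)) z x"
      using le_J_level[OF n\<xi> n\<xi> zD xy(2)] le_J_sub[OF I_ideal[OF r] xI(1)] by simp
    then obtain a b where ab: "a \<in> I r" "b \<in> I r" "tgt S a = src S x" "tgt S x = src S b"
      "z = a \<cdot> x \<cdot> b" unfolding le_J_def by auto
    have el: "a \<in> elts S" "b \<in> elts S" using ab I_elts[OF r] by auto
    have "(a \<cdot> x, a \<cdot> y) \<in> \<sigma>" using \<sigma>_facts(6)[OF xy(1) ab(1)] ab(3) by simp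
    then have "(a \<cdot> x \<cdot> b, a \<cdot> y \<cdot> b) \<in> \<sigma>"
      using \<sigma>_facts(7)[of "a \<cdot> x" "a \<cdot> y" b] ab(2-4) el xI by simp
    moreover have "a \<cdot> y \<in> I (enat n)"
      using ideal_mul(1)[OF I_ideal[OF vn] xy(3) el(1)] ab(3) par by simp
    then have "a \<cdot> y \<cdot> b \<in> I (enat n)"
      using ideal_mul(2)[OF I_ideal[OF vn] _ el(2), of "a \<cdot> y"] ab(3,4) par el xI by simp
    ultimately show ?thesis using ab(5) by blast
  qed
  show ?thesis
  proof (rule subrelI)
    fix z w assume "(z, w) \<in> nabla S (I (enat (Suc n)))"
    then have zw: "z \<in> I (enat (Suc n))" "w \<in> I (enat (Suc n))" "parallel S z w"
      by (auto simp: nabla_def)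
    obtain z' where z': "z' \<in> I (enat n)" "(z, z') \<in> \<sigma>" using ex[OF zw(1)] by blast
    obtain w' where w': "w' \<in> I (enat n)" "(w, w') \<in> \<sigma>" using ex[OF zw(2)] by blast
    have "parallel S z' w'"
      using \<sigma>_facts(5)[OF z'(2)] \<sigma>_facts(5)[OF w'(2)] zw(3) by (simp add: parallel_def)
    then have "(z', w') \<in> \<sigma>" using nab z' w' by (auto simp: nabla_def)
    then show "(z, w) \<in> \<sigma>" using \<sigma>_facts(3,4) z' w' by meson
  qed
qed

text \<open>The link is handed down by \<open>links_pred\<close> to the bottom, where
  \<open>nabla_I0\<close> holds by triviality of \<open>D 0\<close>; on the way back
  \<open>nabla_step\<close> enlarges the collapsed ideal by one level at a time.\<close>

lemma links_nabla: "enat (Suc n) \<le> r \<Longrightarrow> links \<sigma> n \<Longrightarrow> nabla S (I (enat (Suc n))) \<subseteq> \<sigma>"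
proof (induction n)
  case 0
  then show ?case using nabla_step nabla_I0 by blast
next
  case (Suc n)
  have "enat (Suc n) \<le> r"
    using Suc.prems(1) by (meson enat_ord_simps(1) le_SucI order_refl order_trans)
  then show ?case using Suc nabla_step links_pred by blast
qed

text \<open>If the collapse never stopped, it would reach every finite I_q with q \<le> r. Any two
  elements of I_r lie in a common one of these, so \<sigma> would be the full relation, also for
  \<open>r = \<infinity>\<close>.\<close>

lemma obtain_rees_level:
  assumes "\<sigma> \<noteq> nabla S (I r)"
  obtains q where "enat q < r" "nabla S (I (enat q)) \<subseteq> \<sigma>" "\<not> nabla S (I (enat (Suc q))) \<subseteq> \<sigma>"
proof (rule ccontr)
  assume "\<not> thesis"
  then have step: "nabla S (I (enat q)) \<subseteq> \<sigma> \<Longrightarrow> enat q < r \<Longrightarrow> nabla S (I (enat (Suc q))) \<subseteq> \<sigma>" for q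
    using that by blast
  have all: "enat q \<le> r \<Longrightarrow> nabla S (I (enat q)) \<subseteq> \<sigma>" for q
  proof (induction q)
    case 0
    show ?case by (rule nabla_I0)
  next
    case (Suc q)
    have "enat q < r" using Suc.prems by (meson enat_ord_simps(2) lessI order_less_le_trans)
    then show ?case using Suc step by simp
  qed
  have "nabla S (I r) \<subseteq> \<sigma>"
  proof (rule subrelI)
    fix x y assume xy: "(x, y) \<in> nabla S (I r)"
    then obtain p q where pq: "enat p \<le> r" "x \<in> D p" "enat q \<le> r" "y \<in> D q"
      by (auto simp: nabla_def I_iff)
    have "x \<in> I (enat (max p q))" "y \<in> I (enat (max p q))"
      using pq unfolding I_enat_iff by (meson max.cobounded1, meson max.cobounded2)
    moreover have "enat (max p q) \<le> r" using pq by (simp add: max_def)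
    ultimately show "(x, y) \<in> \<sigma>" using all xy by (auto simp: nabla_def)
  qed
  moreover have "\<sigma> \<subseteq> nabla S (I r)" using \<sigma>_facts(1,5) by (auto simp: nabla_def)
  ultimately show False using assms by blast
qed

lemma cong_pairs:
  assumes q: "\<not> nabla S (I (enat (Suc q))) \<subseteq> \<sigma>" and xy: "(x, y) \<in> \<sigma>"
  shows "(x, y) \<in> nabla S (I (enat q)) \<or>
    (\<exists>p. q < p \<and> enat p \<le> r \<and> x \<in> D p \<and> y \<in> D p \<and> (x, y) \<in> green_H S \<and>
      (q + 2 \<le> p \<longrightarrow> (x, y) \<in> zeta S))"
proof -
  have nolink: "\<not> links \<sigma> n" if "q \<le> n" "enat (Suc n) \<le> r" for n
  proof
    assume "links \<sigma> n"
    then have "nabla S (I (enat (Suc n))) \<subseteq> \<sigma>" using links_nabla that by blast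
    moreover have "I (enat (Suc q)) \<subseteq> I (enat (Suc n))" using that by (intro I_mono) simp
    ultimately show False using q by (auto simp: nabla_def)
  qed
  \<comment> \<open>Here x is on the higher of the two levels. The opposite case follows at the end
    from the symmetry of \<sigma>, H and zeta.\<close>
  have *: "\<exists>p. q < p \<and> enat p \<le> r \<and> x \<in> D p \<and> y \<in> D p \<and> (x, y) \<in> green_H S \<and>
      (q + 2 \<le> p \<longrightarrow> (x, y) \<in> zeta S)"
    if xy: "(x, y) \<in> \<sigma>" and p: "q < p" "enat p \<le> r" "x \<in> D p" and y: "y \<in> D p'" "p' \<le> p" for x y p p'
  proof -
    obtain n where n: "p = Suc n" using p by (cases p) auto
    have "y \<in> I (enat (Suc n))" using y n I_enat_iff by blast
    then have H: "(x, y) \<in> green_H S"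
      using links_if_not_H[of n x y] nolink[of n] xy p n by auto
    then have yD: "y \<in> D p" using H_same_level[OF valid_level[OF r p(2)] p(3)] by blast
    have "(x, y) \<in> zeta S" if qp: "q + 2 \<le> p"
    proof -
      obtain k where k: "n = Suc k" using qp n by (cases n) auto
      have kr: "enat (Suc k) \<le> r"
        using p n k by (meson enat_ord_simps(1) le_SucI order_refl order_trans)
      show ?thesis
        using links_if_not_zeta[of k x y] nolink[of k] xy p yD H n k kr qp by auto
    qed
    then show ?thesis using p yD H by blast
  qed
  obtain p p' where p: "enat p \<le> r" "x \<in> D p" "enat p' \<le> r" "y \<in> D p'"
    using \<sigma>_facts(1)[OF xy] I_iff by blast
  show ?thesis
  proof (cases "p \<le> q \<and> p' \<le> q")
    case True
    then have "x \<in> I (enat q)" "y \<in> I (enat q)" using p I_enat_iff by blast+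
    then show ?thesis using \<sigma>_facts(5)[OF xy] by (simp add: nabla_def)
  next
    case False
    show ?thesis
    proof (cases "p' \<le> p")
      case True
      then show ?thesis using *[OF xy _ p(1,2,4)] False by auto
    next
      case F: False
      have "\<exists>p. q < p \<and> enat p \<le> r \<and> y \<in> D p \<and> x \<in> D p \<and> (y, x) \<in> green_H S \<and>
        (q + 2 \<le> p \<longrightarrow> (y, x) \<in> zeta S)"
        using *[OF \<sigma>_facts(3)[OF xy] _ p(3,4,2)] False F by auto
      then show ?thesis
        using green_H_sym psg_congD(3)[OF zeta_greatest(1)] by blast
    qed
  qed
qed

end

end

section \<open>The classification\<close>

context separated_chain
begin

lemma group_class_level: "enat p < \<xi> \<Longrightarrow> group_class S (G p)"
  using groups by unfold_locales blast

abbreviation ident :: "nat \<Rightarrow> 'a" where "ident p \<equiv> \<one>\<^bsub>class_group S (G p)\<^esub>"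

lemma ident_level:
  assumes p: "enat p < \<xi>"
  shows "ident p \<in> G p" "ident p \<in> D p" "D p = green_J S `` {ident p}"
proof -
  interpret grp: group_class S "G p" by (rule group_class_level[OF p])
  show 1: "ident p \<in> G p" by (rule grp.e_G)
  then show 2: "ident p \<in> D p" using groups[OF p] by blast
  show "D p = green_J S `` {ident p}" by (rule D_eq(2)[OF p 2])
qed

context
  fixes r
  assumes r: "valid r"
begin

lemma D_subset_I: "enat p \<le> r \<Longrightarrow> D p \<subseteq> I r"
  using I_iff by blast

text \<open>This is the bridge to \<open>down\<close>, which generates congruences on all of
  \<open>S\<close> while \<sigma> is given on I_r. Intersecting with zeta keeps \<sigma> inside H,
  where extension by equality is available.\<close>

lemma cong_zeta_restrict:
  assumes \<sigma>: "psg_cong (sub S (I r)) \<sigma>"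
  shows "psg_cong S (\<sigma> \<inter> zeta S \<union> Id_on (elts S))"
proof -
  have I: "psg_ideal S (I r)" by (rule I_ideal[OF r])
  have "psg_cong (sub S (elts S)) (zeta S)" using zeta_greatest(1) by simp
  then have z: "psg_cong (sub S (I r)) (zeta S \<inter> I r \<times> I r)"
    by (rule psg_cong_restrict[OF _ I]) (use I_elts[OF r] in blast)
  have "psg_cong (sub S (I r)) (\<Inter>{\<sigma>, zeta S \<inter> I r \<times> I r})"
    by (rule psg_cong_Inter) (use \<sigma> z in auto)
  moreover have "\<Inter>{\<sigma>, zeta S \<inter> I r \<times> I r} = \<sigma> \<inter> zeta S"
    using psg_congD(1)[OF \<sigma>] by auto
  ultimately show ?thesis
    using psg_cong_extend[OF I] zeta_greatest(2) by auto
qed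

lemma congruence_is_rees_nu:
  assumes \<sigma>: "psg_cong (sub S (I r)) \<sigma>" and ne: "\<sigma> \<noteq> nabla S (I r)"
  shows "\<exists>q N. \<sigma> = rees (sub S (I r)) (I (enat q)) \<union>
       (\<Union>p \<in> {p. q + 1 \<le> p \<and> enat p \<le> r}. nu S (D p) (N p)) \<and>
       enat q < r \<and>
       (\<forall>p. q + 1 \<le> p \<and> enat p \<le> r \<longrightarrow> N p \<lhd> class_group S (G p)) \<and>
       (\<forall>p. q + 2 \<le> p \<and> enat p \<le> r \<longrightarrow> N p \<subseteq> Z_grp S (G p)) \<and>
       (\<forall>p t. q + 1 \<le> p \<and> p < t \<and> enat t \<le> r \<longrightarrow> down S (D t) (N t) (G p) \<subseteq> N p)"
proof -
  note f = psg_congD[OF \<sigma>, simplified]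
  have I: "psg_ideal S (I r)" by (rule I_ideal[OF r])
  obtain q where q: "enat q < r" "nabla S (I (enat q)) \<subseteq> \<sigma>" "\<not> nabla S (I (enat (Suc q))) \<subseteq> \<sigma>"
    using obtain_rees_level[OF r \<sigma> ne] by blast
  note pairs = cong_pairs[OF r \<sigma> q(3)]
  have vq: "valid (enat q)" using valid_level[OF r] q(1) by (simp add: valid_enat)
  \<comment> \<open>The only elements that can serve at level p are those of \<open>G p\<close>
    related to its identity; \<open>cong_normal\<close> shows that they form a normal
    subgroup.\<close>
  define N where "N p = {g \<in> G p. (ident p, g) \<in> \<sigma>}" for p
  have lev: "enat p < \<xi>" if "enat p \<le> r" for p using valid_level[OF r that] .
  have eI: "ident p \<in> I r" if "enat p \<le> r" for p
    using ident_level(2)[OF lev[OF that]] D_subset_I[OF that] by blast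
  have norm: "N p \<lhd> class_group S (G p)" if p: "enat p \<le> r" for p
    unfolding N_def using group_class.cong_normal[OF group_class_level[OF lev[OF p]] I eI[OF p] \<sigma>] .
  have nu_in: "(u, v) \<in> \<sigma>" if p: "enat p \<le> r" and uv: "(u, v) \<in> nu S (D p) (N p)" for u v p
    using group_class.nu_imp_cong[OF group_class_level[OF lev[OF p]] I eI[OF p] \<sigma> norm[OF p]]
      uv[unfolded ident_level(3)[OF lev[OF p]]] by (auto simp: N_def)
  have in_nu: "(u, v) \<in> nu S (D p) (N p)"
    if p: "enat p \<le> r" and uv: "(u, v) \<in> \<sigma>" "(u, v) \<in> green_H S" "u \<in> D p" for u v p
    using group_class.cong_imp_nu[OF group_class_level[OF lev[OF p]] I eI[OF p] \<sigma> norm[OF p] _ uv(1,2)]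
      uv(3) unfolding ident_level(3)[OF lev[OF p], symmetric] by (simp add: N_def)
  have zeta_level: "(u, v) \<in> zeta S"
    if p: "q + 2 \<le> p" "enat p \<le> r" and uv: "(u, v) \<in> \<sigma>" "u \<in> D p" for u v p
  proof -
    have "u \<notin> I (enat q)"
      using I_level_iff[OF vq lev[OF p(2)] uv(2)] p(1) by simp
    then have "(u, v) \<notin> nabla S (I (enat q))" by (simp add: nabla_def)
    then obtain p' where "enat p' \<le> r" "u \<in> D p'" "q + 2 \<le> p' \<longrightarrow> (u, v) \<in> zeta S"
      using pairs[OF uv(1)] by blast
    then show ?thesis using level_unique[OF lev[OF p(2)] lev[of p'] uv(2)] p(1) by blast
  qed
  have "\<sigma> = rees (sub S (I r)) (I (enat q)) \<union>
       (\<Union>p \<in> {p. q + 1 \<le> p \<and> enat p \<le> r}. nu S (D p) (N p))" (is "_ = ?R")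
  proof
    show "\<sigma> \<subseteq> ?R"
    proof (rule subrelI)
      fix x y assume xy: "(x, y) \<in> \<sigma>"
      from pairs[OF xy] show "(x, y) \<in> ?R"
      proof
        assume "(x, y) \<in> nabla S (I (enat q))"
        then show ?thesis by (simp add: rees_def)
      next
        assume "\<exists>p. q < p \<and> enat p \<le> r \<and> x \<in> D p \<and> y \<in> D p \<and> (x, y) \<in> green_H S \<and>
          (q + 2 \<le> p \<longrightarrow> (x, y) \<in> zeta S)"
        then obtain p where p: "q < p" "enat p \<le> r" "x \<in> D p" "(x, y) \<in> green_H S" by blast
        then have "(x, y) \<in> nu S (D p) (N p)" using in_nu xy by blast
        then show ?thesis using p by auto
      qed
    qed
    show "?R \<subseteq> \<sigma>" using q(2) f(2) nu_in by (auto simp: rees_def)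
  qed
  moreover have "N p \<subseteq> Z_grp S (G p)" if p: "q + 2 \<le> p" "enat p \<le> r" for p
    using zeta_level[OF p _ ident_level(2)[OF lev[OF p(2)]]] unfolding N_def Z_grp_def by blast
  moreover have "down S (D t) (N t) (G p) \<subseteq> N p" if p: "q + 1 \<le> p" "p < t" "enat t \<le> r" for p t
  proof
    fix g assume "g \<in> down S (D t) (N t) (G p)"
    then have g: "g \<in> G p" "(ident p, g) \<in> cong_gen S (nu S (D t) (N t))"
      by (auto simp: down_def)
    have pr: "enat p \<le> r"
      using p(2,3) by (meson enat_ord_simps(2) order_less_imp_le order_less_le_trans)
    \<comment> \<open>From t > p \<ge> q + 1 it follows that level t is in the range where \<sigma>
      lies inside zeta. Hence \<open>nu\<close> at level t, and the congruence on \<open>S\<close>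
      generated by it, stay inside the extension of \<sigma> \<inter> zeta.\<close>
    have "q + 2 \<le> t" using p by simp
    moreover have "u \<in> D t" if "(u, v) \<in> nu S (D t) (N t)" for u v
      using that by (simp add: nu_def)
    ultimately have "nu S (D t) (N t) \<subseteq> \<sigma> \<inter> zeta S \<union> Id_on (elts S)"
      using zeta_level[OF _ p(3)] nu_in[OF p(3)] by (intro subrelI UnI1 IntI) metis+
    then have "(ident p, g) \<in> \<sigma> \<inter> zeta S \<union> Id_on (elts S)"
      using cong_gen_least[OF cong_zeta_restrict[OF \<sigma>]] g(2) by blast
    then have "(ident p, g) \<in> \<sigma>" using f(2)[OF eI[OF pr]] by auto
    then show "g \<in> N p" using g(1) by (simp add: N_def)
  qed
  ultimately show ?thesis
    using norm q(1) by (intro exI[of _ q] exI[of _ N]) blast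
qed

text \<open>The hypothesis on \<open>N\<close> places \<open>nu\<close> below zeta. This keeps the
  generated congruence inside H and also shows that the family intersected in
  \<open>cong_gen\<close> is nonempty.\<close>

lemma psg_cong_gen_nu:
  assumes p: "enat p < \<xi>" and N: "N \<subseteq> Z_grp S (G p)"
  shows "psg_cong S (cong_gen S (nu S (D p) N))" "nu S (D p) N \<subseteq> cong_gen S (nu S (D p) N)"
    "cong_gen S (nu S (D p) N) \<subseteq> green_H S"
proof -
  have z: "nu S (D p) N \<subseteq> zeta S"
    using group_class.nu_subset_zeta[OF group_class_level[OF p] N] ident_level(3)[OF p] by simp
  show "psg_cong S (cong_gen S (nu S (D p) N))"
    unfolding cong_gen_def by (rule psg_cong_Inter) (use z zeta_greatest(1) in auto)
  show "nu S (D p) N \<subseteq> cong_gen S (nu S (D p) N)" by (auto simp: cong_gen_def)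
  show "cong_gen S (nu S (D p) N) \<subseteq> green_H S"
    using cong_gen_least[OF zeta_greatest(1) z] zeta_greatest(2) by blast
qed

lemma rees_nu_is_congruence:
  assumes q: "enat q < r"
    and norm: "\<And>p. q + 1 \<le> p \<Longrightarrow> enat p \<le> r \<Longrightarrow> N p \<lhd> class_group S (G p)"
    and Z: "\<And>p. q + 2 \<le> p \<Longrightarrow> enat p \<le> r \<Longrightarrow> N p \<subseteq> Z_grp S (G p)"
    and down: "\<And>p t. q + 1 \<le> p \<Longrightarrow> p < t \<Longrightarrow> enat t \<le> r \<Longrightarrow> down S (D t) (N t) (G p) \<subseteq> N p"
  shows "psg_cong (sub S (I r)) (rees (sub S (I r)) (I (enat q)) \<union>
       (\<Union>p \<in> {p. q + 1 \<le> p \<and> enat p \<le> r}. nu S (D p) (N p)))" (is "psg_cong _ ?\<sigma>")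
proof -
  have lev: "enat p < \<xi>" if "enat p \<le> r" for p using valid_level[OF r that] .
  have vq: "valid (enat q)" using lev q by (simp add: valid_enat)
  have Iq: "psg_ideal S (I (enat q))" by (rule I_ideal[OF vq])
  have Ir: "psg_ideal S (I r)" by (rule I_ideal[OF r])
  have IqIr: "I (enat q) \<subseteq> I r" using q by (intro I_mono) simp
  let ?nu = "\<lambda>p. nu S (D p) (N p)"
  have gc: "group_class S (G p)" and Dp: "D p = green_J S `` {ident p}" if "enat p \<le> r" for p
    using group_class_level ident_level(3) lev[OF that] by blast+
  have nuH: "(x, y) \<in> green_H S" "x \<in> D p" "y \<in> D p"
    if "(x, y) \<in> ?nu p" "q + 1 \<le> p" "enat p \<le> r" for x y p
    using group_class.nu_H[OF gc[OF that(3)] norm[OF that(2,3)]] that(1)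
    unfolding Dp[OF that(3), symmetric] by blast+
  \<comment> \<open>The diagonal is absorbed: \<open>nabla\<close> is reflexive on I_q and each
    \<open>nu\<close> on its own level, so only two kinds of pairs have to be followed.\<close>
  have \<sigma>_iff: "(x, y) \<in> ?\<sigma> \<longleftrightarrow> (x, y) \<in> nabla S (I (enat q)) \<or>
      (\<exists>p. q + 1 \<le> p \<and> enat p \<le> r \<and> (x, y) \<in> ?nu p)" for x y
  proof -
    have "(x, x) \<in> nabla S (I (enat q)) \<or> (\<exists>p. q + 1 \<le> p \<and> enat p \<le> r \<and> (x, x) \<in> ?nu p)"
      if "x \<in> I r" for x
    proof -
      obtain p where p: "enat p \<le> r" "x \<in> D p" using \<open>x \<in> I r\<close> I_iff by blast
      show ?thesis
      proof (cases "p \<le> q")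
        case True
        then have "x \<in> I (enat q)" using p I_enat_iff by blast
        then show ?thesis by (simp add: nabla_def parallel_def)
      next
        case False
        then have "(x, x) \<in> ?nu p"
          using group_class.nu_refl[OF gc[OF p(1)] norm[OF _ p(1)], of x] p(2) Dp[OF p(1)] by simp
        then show ?thesis using p False by (metis Suc_eq_plus1 not_less_eq_eq)
      qed
    qed
    then show ?thesis by (auto simp: rees_def)
  qed
  \<comment> \<open>One claim for left and right multiplication: s and t stand for the products of x
    and y with a common element. Assumption \<open>st\<close> says that every congruence relating x
    and y relates s and t, and \<open>J\<close> keeps s and t on a common level k \<le> p.\<close>
  have compat: "(s, t) \<in> ?\<sigma>"
    if xy: "(x, y) \<in> ?nu p" and p: "q + 1 \<le> p" "enat p \<le> r"
      and st: "\<And>\<tau>. psg_cong S \<tau> \<Longrightarrow> (x, y) \<in> \<tau> \<Longrightarrow> (s, t) \<in> \<tau>"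
      and el: "s \<in> elts S" "t \<in> elts S" and par: "parallel S s t"
      and le: "le_J S s x" and J: "le_J S s t" "le_J S t s"
      and top: "s \<in> D p \<Longrightarrow> t \<in> D p \<Longrightarrow> (s, t) \<in> ?nu p"
    for x y s t p
  proof -
    obtain k where k: "enat k < \<xi>" "s \<in> D k" using obtain_level[OF el(1)] by blast
    have tk: "t \<in> D k" using D_upI[OF k el(2) J] .
    have kp: "k \<le> p" using le_J_level[OF k(1) lev[OF p(2)] k(2) nuH(2)[OF xy p]] le by blast
    then have kr: "enat k \<le> r" using p(2) by (meson enat_ord_simps(1) order_trans)
    consider "k \<le> q" | "k = p" | "q + 1 \<le> k" "k < p" using kp by linarith
    then show ?thesis
    proof cases
      case 1
      then have "s \<in> I (enat q)" "t \<in> I (enat q)" using k tk I_enat_iff by blast+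
      then show ?thesis unfolding \<sigma>_iff using par by (simp add: nabla_def)
    next
      case 2
      then show ?thesis unfolding \<sigma>_iff using top k tk p by blast
    next
      case 3
      let ?\<tau> = "cong_gen S (?nu p)"
      have "q + 2 \<le> p" using 3 by simp
      note g = psg_cong_gen_nu[OF lev[OF p(2)] Z[OF this p(2)]]
      have stt: "(s, t) \<in> ?\<tau>" using st[OF g(1)] xy g(2) by blast
      \<comment> \<open>The whole of \<open>S\<close> is taken as the ideal in
        \<open>cong_imp_nu\<close>, because \<open>down\<close> refers to a congruence generated on
        \<open>S\<close>.\<close>
      have ideal: "psg_ideal S (elts S)"
        using el(1) unfolding psg_ideal_def by auto
      have "(s, t) \<in> nu S (green_J S `` {ident k}) (N k)"
      proof (rule group_class.cong_imp_nu[OF gc[OF kr] ideal])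
        show "ident k \<in> elts S" using D_eq(1)[OF k(1) ident_level(2)[OF k(1)]] .
        show "psg_cong (sub S (elts S)) ?\<tau>" using g(1) by simp
        show "N k \<lhd> class_group S (G k)" by (rule norm[OF 3(1) kr])
        show "{g \<in> G k. (ident k, g) \<in> ?\<tau>} \<subseteq> N k"
          using down[OF 3 p(2)] by (simp add: down_def)
        show "(s, t) \<in> ?\<tau>" "(s, t) \<in> green_H S" using stt g(3) by blast+
        show "s \<in> green_J S `` {ident k}" using k(2) Dp[OF kr] by simp
      qed
      then show ?thesis unfolding \<sigma>_iff using 3(1) kr Dp[OF kr] by auto
    qed
  qed
  show ?thesis
  proof (rule psg_congI)
    fix x y assume xy: "(x, y) \<in> ?\<sigma>"
    have par: "parallel S x y" and xyI: "x \<in> I r" "y \<in> I r"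
    proof -
      have "parallel S x y \<and> x \<in> I r \<and> y \<in> I r"
        using xy[unfolded \<sigma>_iff]
      proof
        assume "(x, y) \<in> nabla S (I (enat q))"
        then show ?thesis using IqIr by (auto simp: nabla_def)
      next
        assume "\<exists>p. q + 1 \<le> p \<and> enat p \<le> r \<and> (x, y) \<in> ?nu p"
        then show ?thesis using nuH green_H_parallel D_subset_I by blast
      qed
      then show "parallel S x y" "x \<in> I r" "y \<in> I r" by auto
    qed
    show "x \<in> elts (sub S (I r)) \<and> y \<in> elts (sub S (I r)) \<and> parallel (sub S (I r)) x y"
      using par xyI by simp
    show "(y, x) \<in> ?\<sigma>"
      using xy[unfolded \<sigma>_iff] group_class.nu_sym[OF gc] Dp unfolding \<sigma>_iff
      by (metis (no_types, lifting) case_prodD case_prodI mem_Collect_eq mem_Sigma_iff nabla_def parallel_def)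
    have el: "x \<in> elts S" "y \<in> elts S" using xyI I_elts[OF r] by auto
    fix a assume "a \<in> elts (sub S (I r))"
    then have a: "a \<in> I r" "a \<in> elts S" using I_elts[OF r] by auto
    show "(mul (sub S (I r)) a x, mul (sub S (I r)) a y) \<in> ?\<sigma>"
      if "tgt (sub S (I r)) a = src (sub S (I r)) x"
    proof -
      have ty: "tgt S a = src S x" "tgt S a = src S y" using that par by (auto simp: parallel_def)
      have par': "parallel S (a \<cdot> x) (a \<cdot> y)" using par a el ty by (simp add: parallel_def)
      from xy[unfolded \<sigma>_iff] have "(a \<cdot> x, a \<cdot> y) \<in> ?\<sigma>"
      proof
        assume "(x, y) \<in> nabla S (I (enat q))"
        then have "a \<cdot> x \<in> I (enat q)" "a \<cdot> y \<in> I (enat q)"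
          using ideal_mul(1)[OF Iq _ a(2)] ty by (auto simp: nabla_def)
        then show ?thesis unfolding \<sigma>_iff using par' by (simp add: nabla_def)
      next
        assume "\<exists>p. q + 1 \<le> p \<and> enat p \<le> r \<and> (x, y) \<in> ?nu p"
        then obtain p where p: "q + 1 \<le> p" "enat p \<le> r" "(x, y) \<in> ?nu p" by blast
        have H: "le_R S x y" "le_R S y x" using nuH(1)[OF p(3,1,2)] by (simp_all add: green_H_iff)
        show ?thesis
        proof (rule compat[OF p(3,1,2)])
          show "\<And>\<tau>. psg_cong S \<tau> \<Longrightarrow> (x, y) \<in> \<tau> \<Longrightarrow> (a \<cdot> x, a \<cdot> y) \<in> \<tau>"
            using psg_congD(6) a ty by metis
          show "a \<cdot> x \<in> elts S" "a \<cdot> y \<in> elts S" using a el ty by simp_all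
          show "parallel S (a \<cdot> x) (a \<cdot> y)" by (rule par')
          show "le_J S (a \<cdot> x) x" using le_L_imp_J[OF le_L_mul[of x a]] a el ty by simp
          \<comment> \<open>Left multiplication preserves R, so the two products fall to the same
            level; for right multiplication L plays this part.\<close>
          show "le_J S (a \<cdot> x) (a \<cdot> y)" "le_J S (a \<cdot> y) (a \<cdot> x)"
            using le_R_imp_J[OF le_R_left_mul[OF H(1) el(2) a(2) ty(2)]]
              le_R_imp_J[OF le_R_left_mul[OF H(2) el(1) a(2) ty(1)]] a el ty by simp_all
          show "(a \<cdot> x, a \<cdot> y) \<in> ?nu p" if "a \<cdot> x \<in> D p" "a \<cdot> y \<in> D p"
            using group_class.nu_left[OF gc[OF p(2)] norm[OF p(1,2)], of x y a] p(3) a(2) ty(1) that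
            unfolding Dp[OF p(2), symmetric] by blast
        qed
      qed
      then show ?thesis by simp
    qed
    show "(mul (sub S (I r)) x a, mul (sub S (I r)) y a) \<in> ?\<sigma>"
      if "tgt (sub S (I r)) x = src (sub S (I r)) a"
    proof -
      have ty: "tgt S x = src S a" "tgt S y = src S a" using that par by (auto simp: parallel_def)
      have par': "parallel S (x \<cdot> a) (y \<cdot> a)" using par a el ty by (simp add: parallel_def)
      from xy[unfolded \<sigma>_iff] have "(x \<cdot> a, y \<cdot> a) \<in> ?\<sigma>"
      proof
        assume "(x, y) \<in> nabla S (I (enat q))"
        then have "x \<cdot> a \<in> I (enat q)" "y \<cdot> a \<in> I (enat q)"
          using ideal_mul(2)[OF Iq _ a(2)] ty by (auto simp: nabla_def)
        then show ?thesis unfolding \<sigma>_iff using par' by (simp add: nabla_def)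
      next
        assume "\<exists>p. q + 1 \<le> p \<and> enat p \<le> r \<and> (x, y) \<in> ?nu p"
        then obtain p where p: "q + 1 \<le> p" "enat p \<le> r" "(x, y) \<in> ?nu p" by blast
        have H: "le_L S x y" "le_L S y x" using nuH(1)[OF p(3,1,2)] by (simp_all add: green_H_iff)
        show ?thesis
        proof (rule compat[OF p(3,1,2)])
          show "\<And>\<tau>. psg_cong S \<tau> \<Longrightarrow> (x, y) \<in> \<tau> \<Longrightarrow> (x \<cdot> a, y \<cdot> a) \<in> \<tau>"
            using psg_congD(7) a ty by metis
          show "x \<cdot> a \<in> elts S" "y \<cdot> a \<in> elts S" using a el ty by simp_all
          show "parallel S (x \<cdot> a) (y \<cdot> a)" by (rule par')
          show "le_J S (x \<cdot> a) x" using le_R_imp_J[OF le_R_mul[of x a]] a el ty by simp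
          show "le_J S (x \<cdot> a) (y \<cdot> a)" "le_J S (y \<cdot> a) (x \<cdot> a)"
            using le_L_imp_J[OF le_L_right_mul[OF H(1) el(2) a(2) ty(2)]]
              le_L_imp_J[OF le_L_right_mul[OF H(2) el(1) a(2) ty(1)]] a el ty by simp_all
          show "(x \<cdot> a, y \<cdot> a) \<in> ?nu p" if "x \<cdot> a \<in> D p" "y \<cdot> a \<in> D p"
            using group_class.nu_right[OF gc[OF p(2)] norm[OF p(1,2)], of x y a] p(3) a(2) ty(1) that
            unfolding Dp[OF p(2), symmetric] by blast
        qed
      qed
      then show ?thesis by simp
    qed
  next
    fix x assume "x \<in> elts (sub S (I r))"
    then show "(x, x) \<in> ?\<sigma>" by (simp add: rees_def Id_onI)
  next
    fix x y z assume xy: "(x, y) \<in> ?\<sigma>" and yz: "(y, z) \<in> ?\<sigma>"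
    have disj: False if "(v, w) \<in> ?nu p \<or> (w, v) \<in> ?nu p" "q + 1 \<le> p" "enat p \<le> r" "v \<in> I (enat q)" for v w p
    proof -
      have "v \<in> D p" using that(1) nuH[OF _ that(2,3)] by blast
      then show False using I_level_iff[OF vq lev[OF that(3)]] that(2,4) by simp
    qed
    \<comment> \<open>The levels are disjoint, so the level of y decides which kind both pairs are
      and, for \<open>nu\<close>, that they belong to the same p.\<close>
    have "(x, y) \<in> nabla S (I (enat q)) \<and> (y, z) \<in> nabla S (I (enat q)) \<or>
      (\<exists>p. q + 1 \<le> p \<and> enat p \<le> r \<and> (x, y) \<in> ?nu p \<and> (y, z) \<in> ?nu p)"
    proof -
      have eq: "p = p'" if "(x, y) \<in> ?nu p" "q + 1 \<le> p" "enat p \<le> r"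
        "(y, z) \<in> ?nu p'" "q + 1 \<le> p'" "enat p' \<le> r" for p p'
        using level_unique[OF lev[OF that(3)] lev[OF that(6)]] nuH(3)[OF that(1-3)] nuH(2)[OF that(4-6)] .
      have n1: "(x, y) \<in> nabla S (I (enat q)) \<Longrightarrow> y \<in> I (enat q)"
        and n2: "(y, z) \<in> nabla S (I (enat q)) \<Longrightarrow> y \<in> I (enat q)" by (simp_all add: nabla_def)
      from xy[unfolded \<sigma>_iff] show ?thesis
      proof
        assume 1: "(x, y) \<in> nabla S (I (enat q))"
        then show ?thesis using yz[unfolded \<sigma>_iff] n1 disj[of y z] by blast
      next
        assume "\<exists>p. q + 1 \<le> p \<and> enat p \<le> r \<and> (x, y) \<in> ?nu p"
        then obtain p where p: "q + 1 \<le> p" "enat p \<le> r" "(x, y) \<in> ?nu p" by blast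
        then have "(y, z) \<notin> nabla S (I (enat q))" using n2 disj[of y x p] by blast
        then obtain p' where p': "q + 1 \<le> p'" "enat p' \<le> r" "(y, z) \<in> ?nu p'"
          using yz[unfolded \<sigma>_iff] by blast
        then show ?thesis using eq[OF p(3,1,2) p'(3,1,2)] p by blast
      qed
    qed
    then show "(x, z) \<in> ?\<sigma>"
    proof (elim disjE conjE exE)
      assume "(x, y) \<in> nabla S (I (enat q))" "(y, z) \<in> nabla S (I (enat q))"
      then have "(x, z) \<in> nabla S (I (enat q))" by (simp add: nabla_def parallel_def)
      then show ?thesis by (simp add: rees_def)
    next
      fix p assume p: "q + 1 \<le> p" "enat p \<le> r" "(x, y) \<in> ?nu p" "(y, z) \<in> ?nu p"
      have "(x, z) \<in> ?nu p"
        using group_class.nu_trans[OF gc[OF p(2)] norm[OF p(1,2)], of x y z] p(3,4)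
        unfolding Dp[OF p(2), symmetric] by blast
      then show ?thesis using p(1,2) by auto
    qed
  qed
qed

end

end

theorem theorem10p16:
  fixes U :: "('a, 'o) psg" and \<xi> :: enat and D G :: "nat \<Rightarrow> 'a set" and r :: enat
  assumes height: "1 \<le> \<xi>"
    and chain: "chain_of_ideals U \<xi> D"
    and groups: "\<And>q. enat q < \<xi> \<Longrightarrow> group_H_class U (G q) \<and> G q \<subseteq> D q"
    and trivial: "\<And>A B. \<lbrakk>A \<in> objs U; B \<in> objs U\<rbrakk> \<Longrightarrow> \<exists>!x. x \<in> hom_set U A B \<and> x \<in> D 0"
    and sep1: "\<And>x y. \<lbrakk>enat 1 < \<xi>; x \<in> D 1; y \<in> D 1 - H_class U x; parallel U x y\<rbrakk>
      \<Longrightarrow> \<exists>(x', y') \<in> cong_gen (sub U (I_layer D (enat 1))) {(x, y)}. x' \<in> D 1 \<and> y' \<in> D 0"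
    and sep: "\<And>p. \<lbrakk>2 \<le> p; enat p < \<xi>\<rbrakk> \<Longrightarrow> Sep_zeta (sub U (I_layer D (enat p)))"
    and r: "r < \<xi> \<or> r = \<infinity> \<and> \<xi> = \<infinity>"
  shows "{\<sigma>. psg_cong (sub U (I_layer D r)) \<sigma>} =
    {nabla U (I_layer D r)} \<union>
    {rees (sub U (I_layer D r)) (I_layer D (enat q)) \<union>
       (\<Union>p \<in> {p. q + 1 \<le> p \<and> enat p \<le> r}. nu U (D p) (N p)) | q N.
       enat q < r \<and>
       (\<forall>p. q + 1 \<le> p \<and> enat p \<le> r \<longrightarrow> N p \<lhd> class_group U (G p)) \<and>
       (\<forall>p. q + 2 \<le> p \<and> enat p \<le> r \<longrightarrow> N p \<subseteq> Z_grp U (G p)) \<and>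
       (\<forall>p t. q + 1 \<le> p \<and> p < t \<and> enat t \<le> r \<longrightarrow> down U (D t) (N t) (G p) \<subseteq> N p)}"
    (is "?C = ?R")
proof -
  have c: "partial_semigroup U" "\<And>x. x \<in> elts U \<Longrightarrow> regular_elt U x"
    "\<And>J. J \<in> J_classes U \<Longrightarrow> stable U J" "D ` {q. enat q < \<xi>} = J_classes U"
    "\<And>p q. enat p < \<xi> \<Longrightarrow> enat q < \<xi> \<Longrightarrow> J_le U (D p) (D q) \<longleftrightarrow> p \<le> q"
    using chain unfolding chain_of_ideals_def by blast+
  interpret partial_semigroup U by (rule c(1))
  interpret separated_chain U \<xi> D G
    by (unfold_locales; fact c groups trivial sep1 sep)
  have v: "valid r" using r by (simp add: valid_def)
  show ?thesis
  proof
    show "?C \<subseteq> ?R"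
    proof
      fix \<sigma> assume "\<sigma> \<in> ?C"
      then have \<sigma>: "psg_cong (sub U (I_layer D r)) \<sigma>" by (rule CollectD)
      show "\<sigma> \<in> ?R"
      proof (cases "\<sigma> = nabla U (I_layer D r)")
        case True
        show ?thesis unfolding True by (rule UnI1, rule singletonI)
      next
        case False
        show ?thesis by (rule UnI2, rule CollectI, rule congruence_is_rees_nu[OF v \<sigma> False])
      qed
    qed
    show "?R \<subseteq> ?C"
    proof
      fix \<sigma> assume "\<sigma> \<in> ?R"
      then have "psg_cong (sub U (I_layer D r)) \<sigma>"
      proof (elim UnE CollectE exE conjE)
        assume "\<sigma> \<in> {nabla U (I_layer D r)}"
        then show ?thesis using psg_cong_nabla[OF I_ideal[OF v]] by simp
      next
        fix q N
        assume \<sigma>: "\<sigma> = rees (sub U (I_layer D r)) (I_layer D (enat q)) \<union>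
            (\<Union>p \<in> {p. q + 1 \<le> p \<and> enat p \<le> r}. nu U (D p) (N p))"
          and N: "enat q < r"
            "\<forall>p. q + 1 \<le> p \<and> enat p \<le> r \<longrightarrow> N p \<lhd> class_group U (G p)"
            "\<forall>p. q + 2 \<le> p \<and> enat p \<le> r \<longrightarrow> N p \<subseteq> Z_grp U (G p)"
            "\<forall>p t. q + 1 \<le> p \<and> p < t \<and> enat t \<le> r \<longrightarrow> down U (D t) (N t) (G p) \<subseteq> N p"
        show ?thesis
          unfolding \<sigma> by (rule rees_nu_is_congruence[OF v N(1)]) (use N(2-4) in metis)+
      qed
      then show "\<sigma> \<in> ?C" by (rule CollectI)
    qed
  qed
qed

end
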